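(* Identify inchworm paths with their circle sequences $C=C_1C_2\cdots C_k$. Define a map $f$ recursively by $f(\varepsilon)=\varepsilon$ and $$f(C)=\begin{cases}UD\,f(C') & \text{if } C=C_1C' \text{ is of form (a)},\\ U\,f(C')\,D\,f(C'') & \text{if } C=C_1C'C_jC''\text{ is of form (b)}.\end{cases}$$ Then for every $n\ge0$, $f$ is a bijection from the set of inchworm paths of width $4n$ onto the set of Dyck paths of length $2n$, and it sends every inchworm path of width $4n$ with kissing number $k$ to a Dyck path with exactly $2n-k$ peaks $UD$.
   Context: Consider the hexagonal packing of the plane by circles of radius $2$ with centers $(2+4i+2j,\,2\sqrt3\,j)$, $i,j\in\mathbb Z$; the origin is the tangency point of two horizontally adjacent circles. The tangency points cut every circle into six arcs. Traversed from left to right these give six types of steps (angles measured on the circle carrying the arc): $U$ from $180^\circ$ to $120^\circ$ (displacement $(1,\sqrt3)$), $F$ from $120^\circ$ to $60^\circ$ (displacement $(2,0)$), $D$ from $60^\circ$ to $0^\circ$ (displacement $(1,-\sqrt3)$), $\overline U$ from $300^\circ$ to $360^\circ$ (displacement $(1,\sqrt3)$), $\overline F$ from $240^\circ$ to $300^\circ$ (displacement $(2,0)$), $\overline D$ from $180^\circ$ to $240^\circ$ (displacement $(1,-\sqrt3)$). A path in the packing starts at the origin, is a concatenation of such arcs of circles of the packing, each starting where the previous one ends, and stays in the quarter plane $x,y\ge 0$. Equivalently, it is a word in $\{U,F,D,\overline U,\overline F,\overline D\}$ whose first step (if any) is $U$, in which $U$ or $\overline F$ can only be followed by $F$ or $\overline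 U$; $F$ or $\overline D$ only by $\overline F$ or $D$; $\overline U$ or $D$ only by $U$ or $\overline D$; and which never goes below ordinate $0$. A packing path is such a path ending on the $x$-axis (the empty path $\varepsilon$ included). Its width is the abscissa of its endpoint. Its kissing number is the number of circles of the packing lying below the path (under the path, with center of ordinate $\ge0$, between its starting and ending abscissas) that touch it, touching at a single point included. An inchworm path is a packing path in which neither $\overline U\,\overline D$ nor $DU$ occurs as two consecutive steps. Nonempty inchworm paths with kissing number $k$ correspond one-to-one (by listing from left to right the circles below the path that touch it) to sequences $C=C_1\cdots C_k$ of circles of the packing with centers of nonnegative ordinate such that $C_1$ is centered at $(2,0)$, $C_k$ is centered on the $x$-axis, and for every $i\ge2$ the circle $C_i$ is tangent to $C_{i-1}$ with center strictly to the right of that of $C_{i-1}$; the empty path corresponds to the empty sequence. Each nonempty such sequence has exactly one of two forms: (a) $C=C_1C'$ where $C'$ is a (possibly empty) sequence that is a horizontal translate of the sequence of an inchworm path; (b) $C=C_1C'C_jC''$ where $C'$ is the translate by the vector $(2,2\sqrt3)$ of the sequence of a nonempty inchworm path, $C_j$ is the first circle after $C_1$ centered on the $x$-axis, and $C''$ is a (possibly empty) horizontal translate of the sequence of an inchworm path. In the definition of $f$, translates are identified with the corresponding inchworm paths. Dyck paths are words in $U=(1,1)$, $D=(1,-1)$ starting at the origin, ending on and staying weakly above the $x$-axis; a peak is an occurrence of $UD$ as consecutive steps. *)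

theory Defs
  imports "HOL-Analysis.Analysis" "HOL-Library.Sublist"
begin

text \<open>The plane is the type \<^typ>\<open>complex\<close>; a circle of the packing is represented by its
  centre, the circle itself being \<^term>\<open>sphere c 2\<close>.\<close>

definition packing_centers :: "complex set" where
  "packing_centers =
     range (\<lambda>(i::int, j::int). Complex (2 + 4 * of_int i + 2 * of_int j) (2 * sqrt 3 * of_int j))"

text \<open>The suffix \<open>bar\<close> marks the overlined steps.\<close>

datatype step = U | F | D | Ubar | Fbar | Dbar

fun start_angle :: "step \<Rightarrow> real" where
  "start_angle U = pi"
| "start_angle F = 2 * pi / 3"
| "start_angle D = pi / 3"
| "start_angle Ubar = 5 * pi / 3"
| "start_angle Fbar = 4 * pi / 3"
| "start_angle Dbar = pi"

fun end_angle :: "step \<Rightarrow> real" where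
  "end_angle U = 2 * pi / 3"
| "end_angle F = pi / 3"
| "end_angle D = 0"
| "end_angle Ubar = 2 * pi"
| "end_angle Fbar = 5 * pi / 3"
| "end_angle Dbar = 4 * pi / 3"

text \<open>The centre of the circle that carries the arc of a step which begins at the point \<open>p\<close>.\<close>

definition arc_center :: "complex \<Rightarrow> step \<Rightarrow> complex" where
  "arc_center p s = p - 2 * cis (start_angle s)"

definition arc_points :: "complex \<Rightarrow> step \<Rightarrow> complex set" where
  "arc_points p s =
     (\<lambda>t. arc_center p s + 2 * cis t) ` closed_segment (start_angle s) (end_angle s)"

definition arc_end :: "complex \<Rightarrow> step \<Rightarrow> complex" where
  "arc_end p s = arc_center p s + 2 * cis (end_angle s)"

fun carriers :: "complex \<Rightarrow> step list \<Rightarrow> complex set" where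
  "carriers p [] = {}"
| "carriers p (s # w) = insert (arc_center p s) (carriers (arc_end p s) w)"

fun path_points :: "complex \<Rightarrow> step list \<Rightarrow> complex set" where
  "path_points p [] = {p}"
| "path_points p (s # w) = arc_points p s \<union> path_points (arc_end p s) w"

definition endpoint :: "step list \<Rightarrow> complex" where
  "endpoint w = foldl arc_end 0 w"

definition path_in_packing :: "step list \<Rightarrow> bool" where
  "path_in_packing w \<longleftrightarrow>
     carriers 0 w \<subseteq> packing_centers \<and> (\<forall>z\<in>path_points 0 w. Re z \<ge> 0 \<and> Im z \<ge> 0)"

definition packing_path :: "step list \<Rightarrow> bool" where
  "packing_path w \<longleftrightarrow> path_in_packing w \<and> Im (endpoint w) = 0"

definition width :: "step list \<Rightarrow> real" where
  "width w = Re (endpoint w)"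

definition inchworm_path :: "step list \<Rightarrow> bool" where
  "inchworm_path w \<longleftrightarrow> packing_path w \<and> \<not> sublist [Ubar, Dbar] w \<and> \<not> sublist [D, U] w"

definition lies_below :: "complex \<Rightarrow> step list \<Rightarrow> bool" where
  "lies_below c w \<longleftrightarrow>
     Im c \<ge> 0 \<and>
     (\<forall>z\<in>sphere c 2. 0 \<le> Re z \<and> Re z \<le> width w) \<and>
     (\<forall>z\<in>sphere c 2. \<forall>z'\<in>path_points 0 w. Re z = Re z' \<longrightarrow> Im z \<le> Im z')"

definition kissing_circles :: "step list \<Rightarrow> complex set" where
  "kissing_circles w =
     {c \<in> packing_centers. lies_below c w \<and> sphere c 2 \<inter> path_points 0 w \<noteq> {}}"

definition kissing_number :: "step list \<Rightarrow> nat" where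
  "kissing_number w = card (kissing_circles w)"

definition circle_sequence :: "step list \<Rightarrow> complex list" where
  "circle_sequence w = sorted_key_list_of_set Re (kissing_circles w)"

datatype dyck_step = Up | Down

fun rise :: "dyck_step \<Rightarrow> int" where
  "rise Up = 1"
| "rise Down = -1"

definition dyck_path :: "dyck_step list \<Rightarrow> bool" where
  "dyck_path q \<longleftrightarrow>
     (\<forall>m \<le> length q. sum_list (map rise (take m q)) \<ge> 0) \<and> sum_list (map rise q) = 0"

definition peaks :: "dyck_step list \<Rightarrow> nat" where
  "peaks q = card {i. Suc i < length q \<and> q ! i = Up \<and> q ! Suc i = Down}"

text \<open>\<open>f_graph P Q\<close> is the graph of the recursively defined map \<open>f\<close>. A part of a circle
  sequence that is a translate of the sequence of an inchworm path is replaced by that path.\<close>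

inductive f_graph :: "step list \<Rightarrow> dyck_step list \<Rightarrow> bool" where
  empty: "f_graph [] []"
| form_a: "\<lbrakk> inchworm_path P; inchworm_path P';
             circle_sequence P = C1 # map (\<lambda>c. c + of_real t) (circle_sequence P');
             f_graph P' Q' \<rbrakk>
           \<Longrightarrow> f_graph P ([Up, Down] @ Q')"
| form_b: "\<lbrakk> inchworm_path P; inchworm_path P'; P' \<noteq> []; inchworm_path P'';
             C' = map (\<lambda>c. c + Complex 2 (2 * sqrt 3)) (circle_sequence P');
             C'' = map (\<lambda>c. c + of_real t) (circle_sequence P'');
             circle_sequence P = C1 # C' @ Cj # C'';
             Im Cj = 0; \<forall>c\<in>set C'. Im c \<noteq> 0;
             f_graph P' Q'; f_graph P'' Q'' \<rbrakk>
           \<Longrightarrow> f_graph P ([Up] @ Q' @ [Down] @ Q'')"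

definition f :: "step list \<Rightarrow> dyck_step list" where
  "f P = (THE Q. f_graph P Q)"

end

(*
An inchworm path leaves the axis with U. From then on it is always at the top left or the top right
tangency point of the circle it has just visited, because Ubar must be followed by U and D by Dbar
unless the path ends; since it cannot go below the axis, it ends at its first return to height 0.
Hence a nonempty path is U F ... or U Ubar P' Dbar ..., followed by D (end) or by Fbar and the
continuation of a further path after its initial U. This is the recursive structure of binary trees
with n nodes, which is also that of Dyck paths of length 2n.

For the circles: two circles of the packing have disjoint interiors, so the path never enters an open
disc, and a circle lies below the path as soon as the path stays above the height of its centre over
its horizontal extent. A circle touched at a point below its centre cannot lie below the path, which
leaves exactly the circles under the top left and top right points.
*)

theory Submission
  imports Defs
begin

section \<open>Arcs and the packing\<close>

lemma cis_arc_angles: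
  "cis (2 * pi / 3) = Complex (- 1 / 2) (sqrt 3 / 2)"
  "cis (pi / 3) = Complex (1 / 2) (sqrt 3 / 2)"
  "cis (4 * pi / 3) = Complex (- 1 / 2) (- sqrt 3 / 2)"
  "cis (5 * pi / 3) = Complex (1 / 2) (- sqrt 3 / 2)"
proof -
  have *: "4 * (pi::real) / 3 = pi + pi / 3" "5 * (pi::real) / 3 = 2 * pi - pi / 3" by simp_all
  show "cis (2 * pi / 3) = Complex (- 1 / 2) (sqrt 3 / 2)" "cis (pi / 3) = Complex (1 / 2) (sqrt 3 / 2)"
    by (simp_all add: complex_eq_iff cos_120 sin_120 cos_60 sin_60)
  show "cis (4 * pi / 3) = Complex (- 1 / 2) (- sqrt 3 / 2)"
    unfolding *(1) by (simp only: complex_eq_iff cis.sel complex.sel cos_add sin_add cos_60 sin_60) simp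
  show "cis (5 * pi / 3) = Complex (1 / 2) (- sqrt 3 / 2)"
    unfolding *(2) by (simp only: complex_eq_iff cis.sel complex.sel cos_diff sin_diff cos_60 sin_60) simp
qed

lemma arc_center_simps [simp]:
  "arc_center p U = p + 2"
  "arc_center p F = p + Complex 1 (- sqrt 3)"
  "arc_center p D = p + Complex (- 1) (- sqrt 3)"
  "arc_center p Ubar = p + Complex (- 1) (sqrt 3)"
  "arc_center p Fbar = p + Complex 1 (sqrt 3)"
  "arc_center p Dbar = p + 2"
  by (simp_all add: arc_center_def cis_arc_angles complex_eq_iff)

lemma arc_end_simps [simp]:
  "arc_end p U = p + Complex 1 (sqrt 3)"
  "arc_end p F = p + 2"
  "arc_end p D = p + Complex 1 (- sqrt 3)"
  "arc_end p Ubar = p + Complex 1 (sqrt 3)"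
  "arc_end p Fbar = p + 2"
  "arc_end p Dbar = p + Complex 1 (- sqrt 3)"
  by (simp_all add: arc_end_def cis_arc_angles complex_eq_iff)

section \<open>Translation and concatenation of paths\<close>

lemma arc_translate:
  "arc_center (p + d) s = arc_center p s + d"
  "arc_end (p + d) s = arc_end p s + d"
  by (simp_all add: arc_center_def arc_end_def)

lemma arc_points_translate: "arc_points (p + d) s = (\<lambda>z. z + d) ` arc_points p s"
  unfolding arc_points_def arc_translate image_image by (simp add: algebra_simps)

lemma carriers_translate: "carriers (p + d) w = (\<lambda>z. z + d) ` carriers p w"
  by (induction w arbitrary: p) (auto simp: arc_translate)

lemma path_points_translate: "path_points (p + d) w = (\<lambda>z. z + d) ` path_points p w"
  by (induction w arbitrary: p) (auto simp: arc_translate arc_points_translate)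

lemma foldl_arc_end_translate: "foldl arc_end (p + d) w = foldl arc_end p w + d"
  by (induction w arbitrary: p) (auto simp: arc_translate)

lemma carriers_append: "carriers p (u @ v) = carriers p u \<union> carriers (foldl arc_end p u) v"
  by (induction u arbitrary: p) auto

lemma arc_start_in: "p \<in> arc_points p s"
proof -
  have "p = arc_center p s + 2 * cis (start_angle s)" by (simp add: arc_center_def)
  then show ?thesis unfolding arc_points_def by (metis ends_in_segment(1) image_eqI)
qed

lemma arc_end_in: "arc_end p s \<in> arc_points p s"
  unfolding arc_points_def arc_end_def by (metis ends_in_segment(2) image_eqI)

lemma path_start_in: "p \<in> path_points p w"
  by (cases w) (auto simp: arc_start_in)

lemma path_points_append:
  "path_points p (u @ v) = path_points p u \<union> path_points (foldl arc_end p u) v"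
  by (induction u arbitrary: p) (auto simp: path_start_in)

lemma path_end_in: "foldl arc_end p w \<in> path_points p w"
  by (induction w arbitrary: p) auto

text \<open>Upper steps run through angles in [0, pi] in decreasing order, lower steps through
  angles in [pi, 2 pi] in increasing order. Either way cosine increases along the arc and sine keeps
  its sign.\<close>

lemma arc_bounds:
  assumes "z \<in> arc_points p s"
  shows arc_norm: "(Re z - Re (arc_center p s))\<^sup>2 + (Im z - Im (arc_center p s))\<^sup>2 = 4"
    and arc_Re: "Re p \<le> Re z" "Re z \<le> Re (arc_end p s)"
    and arc_upper: "s \<in> {U, F, D} \<Longrightarrow> Im (arc_center p s) \<le> Im z"
    and arc_lower: "s \<in> {Ubar, Fbar, Dbar} \<Longrightarrow> Im z \<le> Im (arc_center p s)"
proof -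
  obtain t where t: "t \<in> closed_segment (start_angle s) (end_angle s)"
    and z: "z = arc_center p s + 2 * cis t"
    using assms unfolding arc_points_def by blast
  have p: "p = arc_center p s + 2 * cis (start_angle s)" by (simp add: arc_center_def)
  show "(Re z - Re (arc_center p s))\<^sup>2 + (Im z - Im (arc_center p s))\<^sup>2 = 4"
    using sin_cos_squared_add[of t] by (simp add: z power_mult_distrib flip: distrib_left)
  have "cos (start_angle s) \<le> cos t \<and> cos t \<le> cos (end_angle s) \<and>
    (s \<in> {U, F, D} \<longrightarrow> sin t \<ge> 0) \<and> (s \<in> {Ubar, Fbar, Dbar} \<longrightarrow> sin t \<le> 0)"
  proof (cases "s \<in> {U, F, D}")
    case True
    then have "0 \<le> end_angle s" "end_angle s \<le> t" "t \<le> start_angle s" "start_angle s \<le> pi"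
      using t by (auto simp: closed_segment_eq_real_ivl split: if_splits, (use pi_gt_zero in linarith)+)
    then show ?thesis
      using True by (auto intro!: cos_monotone_0_pi_le sin_ge_zero)
  next
    case False
    then have s: "s = Ubar \<or> s = Fbar \<or> s = Dbar" by (cases s) auto
    then have b: "pi \<le> start_angle s" "start_angle s \<le> t" "t \<le> end_angle s" "end_angle s \<le> 2 * pi"
      using t by (auto simp: closed_segment_eq_real_ivl split: if_splits)
    \<comment> \<open>Subtracting 2 pi moves the angles into [-pi, 0], where cosine
      increases.\<close>
    have "cos (start_angle s - 2 * pi) \<le> cos (t - 2 * pi)"
      "cos (t - 2 * pi) \<le> cos (end_angle s - 2 * pi)"
      by (rule cos_monotone_minus_pi_0'; use b in simp)+
    moreover have "0 \<le> sin (t - pi)" by (rule sin_ge_zero) (use b in auto)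
    ultimately show ?thesis using False by (simp add: cos_diff sin_diff)
  qed
  then show "Re p \<le> Re z" "Re z \<le> Re (arc_end p s)"
    "s \<in> {U, F, D} \<Longrightarrow> Im (arc_center p s) \<le> Im z"
    "s \<in> {Ubar, Fbar, Dbar} \<Longrightarrow> Im z \<le> Im (arc_center p s)"
    by (subst p, simp_all add: z arc_end_def)
qed

lemma arc_Im_lower:
  assumes "z \<in> arc_points p s"
  shows "Im (arc_center p s) - 2 \<le> Im z"
proof -
  have "(Im z - Im (arc_center p s))\<^sup>2 \<le> 4"
    using arc_norm[OF assms] zero_le_power2[of "Re z - Re (arc_center p s)"] by linarith
  then have "\<bar>Im z - Im (arc_center p s)\<bar> \<le> 2"
    using abs_le_square_iff[of "Im z - Im (arc_center p s)" 2] by simp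
  then show ?thesis by simp
qed

section \<open>The lattice of centres and its distances\<close>

lemma packing_centersE:
  assumes "c \<in> packing_centers"
  obtains i j :: int where "c = Complex (2 + 4 * of_int i + 2 * of_int j) (2 * sqrt 3 * of_int j)"
  using assms unfolding packing_centers_def by auto

lemma packing_centersI:
  "Complex (2 + 4 * of_int i + 2 * of_int j) (2 * sqrt 3 * of_int j) \<in> packing_centers"
  unfolding packing_centers_def by (rule image_eqI[where x = "(i, j)"]) auto

text \<open>The centres form a coset of the lattice generated by (4, 0) and (2, 2 sqrt 3).\<close>

lemma packing_translate:
  assumes "c \<in> packing_centers"
  shows "c + (of_real (4 * of_int k) + of_int l * Complex 2 (2 * sqrt 3)) \<in> packing_centers"
proof -
  obtain i j where c: "c = Complex (2 + 4 * of_int i + 2 * of_int j) (2 * sqrt 3 * of_int j)"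
    using assms by (rule packing_centersE)
  have "c + (of_real (4 * of_int k) + of_int l * Complex 2 (2 * sqrt 3)) =
      Complex (2 + 4 * of_int (i + k) + 2 * of_int (j + l)) (2 * sqrt 3 * of_int (j + l))"
    by (simp add: c complex_eq_iff algebra_simps)
  then show ?thesis by (simp only: packing_centersI)
qed

lemma packing_shift_horizontal: "c \<in> packing_centers \<Longrightarrow> c + of_real (4 * real n) \<in> packing_centers"
  using packing_translate[of c "int n" 0] by simp

lemma packing_shift_up: "c \<in> packing_centers \<Longrightarrow> c + Complex 2 (2 * sqrt 3) \<in> packing_centers"
  using packing_translate[of c 0 1] by simp

lemma packing_shift_down: "c \<in> packing_centers \<Longrightarrow> c - Complex 2 (2 * sqrt 3) \<in> packing_centers"
  using packing_translate[of c 0 "-1"] by simp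

text \<open>This is the norm form of the hexagonal lattice. Completing the square in either variable
  bounds both integers by 1 in absolute value; the pairs that remain are the origin and its six
  neighbours.\<close>

lemma int_form_cases:
  fixes i j :: int
  assumes "i * i + i * j + j * j \<le> 1"
  shows "(i, j) \<in> {(0,0), (1,0), (-1,0), (0,1), (0,-1), (1,-1), (-1,1)}"
proof -
  define q where "q = i * i + i * j + j * j"
  have "4 * q = (2 * i + j)\<^sup>2 + 3 * j\<^sup>2" "4 * q = (2 * j + i)\<^sup>2 + 3 * i\<^sup>2" "q \<le> 1"
    using assms by (simp_all add: q_def power2_eq_square algebra_simps)
  moreover have "(2 * i + j)\<^sup>2 \<ge> 0" "(2 * j + i)\<^sup>2 \<ge> 0" by simp_all
  ultimately have "3 * j\<^sup>2 \<le> 4" "3 * i\<^sup>2 \<le> 4" by linarith+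
  then have "j\<^sup>2 \<le> 1" "i\<^sup>2 \<le> 1" by linarith+
  then have "\<bar>j\<bar> \<le> 1" "\<bar>i\<bar> \<le> 1" by (simp_all add: abs_square_le_1)
  then have "i \<in> {-1, 0, 1}" "j \<in> {-1, 0, 1}" by auto
  then show ?thesis using assms by auto
qed

text \<open>A difference of centres is (4i + 2j, 2 sqrt 3 j), of squared length 16 (i^2 + ij + j^2).
  Its least nonzero value is 16, taken exactly at the six neighbours.\<close>

lemma packing_dist:
  assumes "c \<in> packing_centers" "c' \<in> packing_centers" "c \<noteq> c'"
  shows "(Re c - Re c')\<^sup>2 + (Im c - Im c')\<^sup>2 \<ge> 16"
    and "(Re c - Re c')\<^sup>2 + (Im c - Im c')\<^sup>2 \<le> 16 \<Longrightarrow>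
      (Re c - Re c', Im c - Im c') \<in> {(4,0), (-4,0), (2, 2 * sqrt 3), (-2, - 2 * sqrt 3),
         (2, - 2 * sqrt 3), (-2, 2 * sqrt 3)}"
proof -
  obtain i1 j1 where c: "c = Complex (2 + 4 * of_int i1 + 2 * of_int j1) (2 * sqrt 3 * of_int j1)"
    using assms(1) by (rule packing_centersE)
  obtain i2 j2 where c': "c' = Complex (2 + 4 * of_int i2 + 2 * of_int j2) (2 * sqrt 3 * of_int j2)"
    using assms(2) by (rule packing_centersE)
  define i j where "i = i1 - i2" and "j = j1 - j2"
  have d: "Re c - Re c' = 4 * of_int i + 2 * of_int j" "Im c - Im c' = 2 * sqrt 3 * of_int j"
    by (simp_all add: c c' i_def j_def algebra_simps)
  have ne: "(i, j) \<noteq> (0, 0)" using assms(3) by (auto simp: c c' i_def j_def)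
  define q where "q = i * i + i * j + j * j"
  have e: "(Re c - Re c')\<^sup>2 + (Im c - Im c')\<^sup>2 = 16 * of_int q"
    unfolding d by (simp add: q_def power2_eq_square algebra_simps)
  have "q \<ge> 1"
    using int_form_cases[of i j] ne by (force simp: q_def)
  then show "(Re c - Re c')\<^sup>2 + (Im c - Im c')\<^sup>2 \<ge> 16"
    unfolding e by linarith
  assume "(Re c - Re c')\<^sup>2 + (Im c - Im c')\<^sup>2 \<le> 16"
  then have "q \<le> 1" unfolding e by linarith
  from int_form_cases[OF this[unfolded q_def]] ne
  have "(i, j) \<in> {(1,0), (-1,0), (0,1), (0,-1), (1,-1), (-1,1)}" by blast
  then show "(Re c - Re c', Im c - Im c') \<in> {(4,0), (-4,0), (2, 2 * sqrt 3),
      (-2, - 2 * sqrt 3), (2, - 2 * sqrt 3), (-2, 2 * sqrt 3)}"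
    unfolding d by (elim insertE emptyE) (simp_all only: prod.inject, simp_all)
qed

lemma packing_eqI:
  assumes "c \<in> packing_centers" "c' \<in> packing_centers"
    "(Re c - Re c')\<^sup>2 + (Im c - Im c')\<^sup>2 < 16"
  shows "c = c'"
  using packing_dist(1)[OF assms(1,2)] assms(3) by fastforce

text \<open>A common point of two circles of the packing is the midpoint of their centres, so it is
  one of the six tangency points of the carrier. An arc contains only two of these, its ends, and
  there the other circle is the reflection of the carrier.\<close>

lemma arc_touch:
  assumes "arc_center p s \<in> packing_centers" "c \<in> packing_centers"
    and z: "z \<in> arc_points p s" and cz: "(Re z - Re c)\<^sup>2 + (Im z - Im c)\<^sup>2 = 4"
  shows "c = arc_center p s \<or> z = p \<and> c = 2 * p - arc_center p s \<or>
    z = arc_end p s \<and> c = 2 * arc_end p s - arc_center p s"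
proof (cases "c = arc_center p s")
  case False
  define e where "e = arc_center p s"
  have ez: "(Re z - Re e)\<^sup>2 + (Im z - Im e)\<^sup>2 = 4" using arc_norm[OF z] by (simp add: e_def)
  \<comment> \<open>Parallelogram law for z - c and z - e, both of length 2. As c and e are at least
    4 apart, 2z - c - e must vanish.\<close>
  have par: "(2 * Re z - Re c - Re e)\<^sup>2 + (2 * Im z - Im c - Im e)\<^sup>2 +
      ((Re c - Re e)\<^sup>2 + (Im c - Im e)\<^sup>2) = 16"
    using ez cz by (simp add: power2_eq_square algebra_simps)
  have ge: "(Re c - Re e)\<^sup>2 + (Im c - Im e)\<^sup>2 \<ge> 16"
    using packing_dist(1)[OF assms(2,1) False] by (simp add: e_def)
  have sq: "(2 * Re z - Re c - Re e)\<^sup>2 \<ge> 0" "(2 * Im z - Im c - Im e)\<^sup>2 \<ge> 0" by simp_all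
  have "(2 * Re z - Re c - Re e)\<^sup>2 = 0" "(2 * Im z - Im c - Im e)\<^sup>2 = 0"
    and le: "(Re c - Re e)\<^sup>2 + (Im c - Im e)\<^sup>2 \<le> 16"
    using par ge sq by linarith+
  then have m: "Re c = 2 * Re z - Re e" "Im c = 2 * Im z - Im e" by auto
  define a b where "a = Re z - Re e" and "b = Im z - Im e"
  have z': "z = e + Complex a b" by (simp add: a_def b_def complex_eq_iff)
  have "Re c - Re e = 2 * a" "Im c - Im e = 2 * b" using m by (simp_all add: a_def b_def)
  then have "(2 * a, 2 * b) \<in> {(4,0), (-4,0), (2, 2 * sqrt 3), (-2, - 2 * sqrt 3),
         (2, - 2 * sqrt 3), (-2, 2 * sqrt 3)}"
    using packing_dist(2)[OF assms(2,1) False] le by (simp add: e_def)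
  then consider "a = 2" "b = 0" | "a = -2" "b = 0" | "a = 1" "b = sqrt 3" | "a = -1" "b = - sqrt 3"
    | "a = 1" "b = - sqrt 3" | "a = -1" "b = sqrt 3"
    by (elim insertE emptyE) simp_all
  \<comment> \<open>The range of abscissas of the arc and its half of the circle rule out the other
    tangency points.\<close>
  then have "z = p \<or> z = arc_end p s"
    using arc_Re[OF z] arc_upper[OF z] arc_lower[OF z] real_sqrt_gt_zero[of 3]
    unfolding z' e_def
    by cases (cases s; simp add: complex_eq_iff)+
  moreover have "c = 2 * z - e" using m by (simp add: complex_eq_iff)
  ultimately show ?thesis by (auto simp: e_def)
qed auto

text \<open>Triangle inequality: the centres are 4 apart and z is at distance 2 from one of
  them.\<close>

lemma packing_outside:
  assumes "e \<in> packing_centers" "c \<in> packing_centers"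
    "(Re z - Re e)\<^sup>2 + (Im z - Im e)\<^sup>2 = 4"
  shows "(Re z - Re c)\<^sup>2 + (Im z - Im c)\<^sup>2 \<ge> 4"
proof (cases "c = e")
  case False
  have 1: "cmod (c - e) \<ge> 4"
    unfolding cmod_def using packing_dist(1)[OF assms(2,1) False]
    by (intro real_le_rsqrt) (simp add: power2_eq_square)
  have 2: "cmod (z - e) = 2" using assms(3) by (simp add: cmod_def)
  have "cmod (c - e) \<le> cmod (z - c) + cmod (z - e)"
    using norm_triangle_ineq[of "c - z" "z - e"] by (simp add: norm_minus_commute)
  then have "2 \<le> cmod (z - c)" using 1 2 by simp
  then have "2\<^sup>2 \<le> (cmod (z - c))\<^sup>2" by (rule power_mono) simp
  then show ?thesis by (simp add: cmod_power2)
qed (use assms in simp)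

lemma path_points_outside:
  assumes "carriers p w \<subseteq> packing_centers" "w \<noteq> []" "z \<in> path_points p w" "c \<in> packing_centers"
  shows "(Re z - Re c)\<^sup>2 + (Im z - Im c)\<^sup>2 \<ge> 4"
  using assms
proof (induction w arbitrary: p)
  case (Cons s w)
  show ?case
  proof (cases "z \<in> arc_points p s")
    case True
    then show ?thesis using packing_outside[OF _ Cons.prems(4) arc_norm[OF True]] Cons.prems(1) by simp
  next
    case False
    then have "z \<in> path_points (arc_end p s) w" using Cons.prems by simp
    \<comment> \<open>An empty rest would consist of the end of the arc alone, which lies on the
      arc.\<close>
    moreover from this have "w \<noteq> []" using False arc_end_in by (cases w) auto
    ultimately show ?thesis using Cons by auto
  qed
qed simp

section \<open>Inchworm paths as binary trees\<close>

datatype btree = Leaf | Node btree btree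

text \<open>The initial \<open>U\<close> is left out because after \<open>Fbar\<close> the path is
  already at the top left point of the next circle, where a \<open>U\<close> from the axis would
  have ended. The left subtree is the raised part, a complete path including its \<open>U\<close>;
  the right subtree is the continuation.\<close>

fun after_first :: "btree \<Rightarrow> step list" where
  "after_first Leaf = []"
| "after_first (Node l r) =
     (if l = Leaf then [F] else [Ubar, U] @ after_first l @ [Dbar]) @
     (if r = Leaf then [D] else Fbar # after_first r)"

definition word :: "btree \<Rightarrow> step list" where
  "word t = (if t = Leaf then [] else U # after_first t)"

text \<open>The expected circle sequence of the tree path, whose width is four times the number of
  nodes. For a nonempty left subtree the circle at \<open>4 * real (size l) + 2\<close> is the
  circle C_j of form (b).\<close>

fun circ :: "btree \<Rightarrow> complex list" where
  "circ Leaf = []"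
| "circ (Node l r) =
     2 # (if l = Leaf then []
          else map (\<lambda>c. c + Complex 2 (2 * sqrt 3)) (circ l) @ [of_real (4 * real (size l) + 2)]) @
     map (\<lambda>c. c + of_real (4 * real (size l) + 4)) (circ r)"

text \<open>The top left tangency point of the circle centred at 2, where the initial
  \<open>U\<close> ends.\<close>

definition first_top :: complex where
  "first_top = Complex 1 (sqrt 3)"

text \<open>Both the translation of form (b) and, as the image of the origin, the point where the
  raised path starts.\<close>

definition ascend :: complex where
  "ascend = Complex 2 (2 * sqrt 3)"

text \<open>The top right tangency point of the circle centred at
  \<open>4 * real (size l) + 2\<close>. This circle is C_j in form (b), and the first circle when
  \<open>l\<close> is \<open>Leaf\<close>.\<close>

definition last_top :: "btree \<Rightarrow> complex" where
  "last_top l = Complex (4 * real (size l) + 3) (sqrt 3)"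

definition shift :: "btree \<Rightarrow> complex" where
  "shift l = of_real (4 * real (size l) + 4)"

abbreviation tree_points :: "btree \<Rightarrow> complex set" where
  "tree_points t \<equiv> path_points first_top (after_first t)"

lemma coords [simp]:
  "Re first_top = 1" "Im first_top = sqrt 3" "Re ascend = 2" "Im ascend = 2 * sqrt 3"
  "Re (last_top l) = 4 * real (size l) + 3" "Im (last_top l) = sqrt 3"
  "Re (shift l) = 4 * real (size l) + 4" "Im (shift l) = 0"
  by (simp_all add: first_top_def ascend_def last_top_def shift_def)

lemma point_sums:
  "first_top + Complex 1 (sqrt 3) = ascend"
  "ascend + Complex 1 (sqrt 3) = first_top + ascend"
  "ascend + of_real (4 * real (size l)) + Complex 1 (- sqrt 3) = last_top l"
  "last_top l + 2 = first_top + shift l"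
  by (simp_all add: complex_eq_iff)

lemma size_pos: "t \<noteq> Leaf \<Longrightarrow> size t \<ge> 1"
  by (cases t) auto

lemma after_first_end:
  "t \<noteq> Leaf \<Longrightarrow> foldl arc_end first_top (after_first t) = of_real (4 * real (size t))"
proof (induction t)
  case (Node l r)
  have "foldl arc_end first_top (if l = Leaf then [F] else [Ubar, U] @ after_first l @ [Dbar]) = last_top l"
    using Node.IH(1) by (auto simp: point_sums foldl_arc_end_translate) (auto simp: complex_eq_iff)
  moreover have "foldl arc_end (last_top l) (if r = Leaf then [D] else Fbar # after_first r) =
      of_real (4 * real (size (Node l r)))"
    using Node.IH(2) by (auto simp: point_sums foldl_arc_end_translate) (auto simp: complex_eq_iff)
  ultimately show ?case by simp
qed simp

lemma inner_end:
  "t \<noteq> Leaf \<Longrightarrow> foldl arc_end (first_top + ascend) (after_first t) = ascend + of_real (4 * real (size t))"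
  by (simp add: foldl_arc_end_translate after_first_end)

lemma body_end:
  "foldl arc_end first_top (if l = Leaf then [F] else [Ubar, U] @ after_first l @ [Dbar]) = last_top l"
  by (auto simp: point_sums inner_end) (auto simp: complex_eq_iff)

lemma tree_points_Node:
  "tree_points (Node l r) =
    (if l = Leaf then arc_points first_top F
     else arc_points first_top Ubar \<union> arc_points ascend U \<union> (\<lambda>z. z + ascend) ` tree_points l \<union>
       arc_points (ascend + of_real (4 * real (size l))) Dbar) \<union>
    (if r = Leaf then arc_points (last_top l) D
     else arc_points (last_top l) Fbar \<union> (\<lambda>z. z + shift l) ` tree_points r)"
proof -
  \<comment> \<open>The end point that \<open>path_points\<close> adds for the empty word already
    lies on the last arc.\<close>
  have e: "insert (arc_end p s) (arc_points p s) = arc_points p s" for p s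
    using arc_end_in by blast
  have body: "path_points first_top (if l = Leaf then [F] else [Ubar, U] @ after_first l @ [Dbar]) =
    (if l = Leaf then arc_points first_top F
     else arc_points first_top Ubar \<union> arc_points ascend U \<union> (\<lambda>z. z + ascend) ` tree_points l \<union>
       arc_points (ascend + of_real (4 * real (size l))) Dbar)"
    using e[of first_top F] e[of "ascend + of_real (4 * real (size l))" Dbar]
    by (auto simp add: path_points_append point_sums inner_end path_points_translate)
  have tail: "path_points (last_top l) (if r = Leaf then [D] else Fbar # after_first r) =
    (if r = Leaf then arc_points (last_top l) D
     else arc_points (last_top l) Fbar \<union> (\<lambda>z. z + shift l) ` tree_points r)"
    using e[of "last_top l" D] by (auto simp add: point_sums path_points_translate)
  show ?thesis unfolding after_first.simps path_points_append body body_end tail ..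
qed

section \<open>Carriers of tree paths are circles of the packing\<close>

lemma packing_horizontal: "of_real (4 * real n + 2) \<in> packing_centers"
proof -
  have "Complex (2 + 4 * of_int (int n) + 2 * of_int 0) (2 * sqrt 3 * of_int 0) \<in> packing_centers"
    by (rule packing_centersI)
  also have "Complex (2 + 4 * of_int (int n) + 2 * of_int 0) (2 * sqrt 3 * of_int 0) = of_real (4 * real n + 2)"
    by (simp add: complex_eq_iff)
  finally show ?thesis .
qed

lemma packing_ascend: "c \<in> packing_centers \<Longrightarrow> c + ascend \<in> packing_centers"
  unfolding ascend_def by (rule packing_shift_up)

lemma packing_shift: "c \<in> packing_centers \<Longrightarrow> c + shift l \<in> packing_centers"
  using packing_shift_horizontal[of c "size l + 1"] by (simp add: shift_def algebra_simps)

lemma arc_center_packing: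
  "arc_center first_top F \<in> packing_centers"
  "arc_center first_top Ubar \<in> packing_centers"
  "arc_center ascend U \<in> packing_centers"
  "arc_center (ascend + of_real (4 * real n)) Dbar \<in> packing_centers"
  "arc_center (last_top l) D \<in> packing_centers"
  "arc_center (last_top l) Fbar \<in> packing_centers"
proof -
  have 0: "2 \<in> packing_centers" using packing_horizontal[of 0] by simp
  \<comment> \<open>Each carrier is written as a circle on the axis plus a lattice vector, with
    coefficients k of (4, 0) and m of (2, 2 sqrt 3).\<close>
  have h: "x = of_real (4 * real n + 2) + (of_real (4 * of_int k) + of_int m * Complex 2 (2 * sqrt 3))
    \<Longrightarrow> x \<in> packing_centers" for x n k m
    using packing_translate[OF packing_horizontal] by simp
  show "arc_center first_top F \<in> packing_centers"
    by (rule h[of _ 0 0 0]) (simp add: complex_eq_iff)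
  show "arc_center first_top Ubar \<in> packing_centers"
    by (rule h[of _ 0 "-1" 1]) (simp add: complex_eq_iff)
  show "arc_center ascend U \<in> packing_centers"
    by (rule h[of _ 0 0 1]) (simp add: complex_eq_iff)
  show "arc_center (ascend + of_real (4 * real n)) Dbar \<in> packing_centers"
    by (rule h[of _ n 0 1]) (simp add: complex_eq_iff)
  show "arc_center (last_top l) D \<in> packing_centers"
    by (rule h[of _ "size l" 0 0]) (simp add: complex_eq_iff)
  show "arc_center (last_top l) Fbar \<in> packing_centers"
    by (rule h[of _ "size l" 0 1]) (simp add: complex_eq_iff)
qed

lemma carriers_after_first: "carriers first_top (after_first t) \<subseteq> packing_centers"
proof (induction t)
  case (Node l r)
  have l: "carriers (first_top + ascend) (after_first l) \<subseteq> packing_centers"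
    using Node.IH(1) by (auto simp: carriers_translate intro: packing_ascend)
  have "carriers first_top (if l = Leaf then [F] else [Ubar, U] @ after_first l @ [Dbar]) \<subseteq> packing_centers"
    using l arc_center_packing(1-3) arc_center_packing(4)[of "size l"] arc_center_packing(5,6)[of l]
    by (auto simp add: carriers_append point_sums inner_end)
  moreover have "carriers (first_top + shift l) (after_first r) \<subseteq> packing_centers"
    using Node.IH(2) by (auto simp: carriers_translate intro: packing_shift)
  then have "carriers (last_top l) (if r = Leaf then [D] else Fbar # after_first r) \<subseteq> packing_centers"
    using arc_center_packing(1-3) arc_center_packing(4)[of "size l"] arc_center_packing(5,6)[of l] by (auto simp add: point_sums)
  ultimately show ?case
    unfolding after_first.simps carriers_append body_end by blast
qed simp

lemma sqrt3: "0 < sqrt (3::real)" "1 < sqrt (3::real)"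
  by simp_all

section \<open>Extents of tree paths and of their circles\<close>

lemma tree_points_cases:
  assumes "z \<in> tree_points (Node l r)"
  obtains (F) "l = Leaf" "z \<in> arc_points first_top F"
  | (Ubar) "l \<noteq> Leaf" "z \<in> arc_points first_top Ubar"
  | (U) "l \<noteq> Leaf" "z \<in> arc_points ascend U"
  | (left) y where "l \<noteq> Leaf" "y \<in> tree_points l" "z = y + ascend"
  | (Dbar) "l \<noteq> Leaf" "z \<in> arc_points (ascend + of_real (4 * real (size l))) Dbar"
  | (D) "r = Leaf" "z \<in> arc_points (last_top l) D"
  | (Fbar) "r \<noteq> Leaf" "z \<in> arc_points (last_top l) Fbar"
  | (right) y where "r \<noteq> Leaf" "y \<in> tree_points r" "z = y + shift l"
  using assms that unfolding tree_points_Node by (cases "l = Leaf"; cases "r = Leaf") auto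

lemma circ_Node:
  "circ (Node l r) = 2 # (if l = Leaf then [] else map (\<lambda>c. c + ascend) (circ l) @ [of_real (4 * real (size l) + 2)]) @
     map (\<lambda>c. c + shift l) (circ r)"
  by (simp add: ascend_def shift_def)

lemma circ_cases:
  assumes "c \<in> set (circ (Node l r))"
  obtains (first) "c = 2"
  | (left) y where "l \<noteq> Leaf" "y \<in> set (circ l)" "c = y + ascend"
  | (return) "l \<noteq> Leaf" "c = of_real (4 * real (size l) + 2)"
  | (right) y where "r \<noteq> Leaf" "y \<in> set (circ r)" "c = y + shift l"
  using assms that unfolding circ_Node by (cases "l = Leaf"; cases "r = Leaf") auto

text \<open>Upper arcs stay above their centres, and lower arcs have centres at height 2 sqrt 3,
  which exceeds the radius.\<close>

lemma tree_points_bounds: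
  assumes "t \<noteq> Leaf" "z \<in> tree_points t"
  shows "1 \<le> Re z \<and> Re z \<le> 4 * real (size t) \<and> 0 \<le> Im z"
  using assms
proof (induction t arbitrary: z)
  case (Node l r)
  note b = arc_Re[of z] arc_upper[of z] arc_Im_lower[of z]
  from Node.prems(2) show ?case
  proof (cases rule: tree_points_cases)
    case F then show ?thesis using b[of first_top F] by simp
  next
    case Ubar then show ?thesis using b(1,2,4)[of first_top Ubar] size_pos[of l] by simp (use sqrt3 in linarith)
  next
    case U then show ?thesis using b[of ascend U] size_pos[of l] by simp (use sqrt3 in linarith)
  next
    case (left y) then show ?thesis using Node.IH(1)[of y] sqrt3 by simp
  next
    case Dbar then show ?thesis
      using b(1,2,4)[of "ascend + of_real (4 * real (size l))" Dbar] by simp (use sqrt3 in linarith)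
  next
    case D then show ?thesis using b[of "last_top l" D] by simp
  next
    case Fbar then show ?thesis using b(1,2,4)[of "last_top l" Fbar] size_pos[of r] by simp (use sqrt3 in linarith)
  next
    case (right y) then show ?thesis using Node.IH(2)[of y] by simp
  qed
qed simp

text \<open>The last disjunction records that circles off the axis keep 2 further away from both
  ends of the path. It separates them from the arcs adjoining a subtree.\<close>

lemma circ_bounds:
  assumes "c \<in> set (circ t)"
  shows "c \<in> packing_centers \<and> 0 \<le> Im c \<and> 2 \<le> Re c \<and> Re c \<le> 4 * real (size t) - 2 \<and>
    (Im c = 0 \<or> 4 \<le> Re c \<and> Re c \<le> 4 * real (size t) - 4)"
  using assms
proof (induction t arbitrary: c)
  case (Node l r)
  from Node.prems show ?case
  proof (cases rule: circ_cases)
    case first then show ?thesis using packing_horizontal[of 0] by simp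
  next
    case (left y) then show ?thesis using Node.IH(1)[of y] sqrt3 by (simp add: packing_ascend)
  next
    case return then show ?thesis using packing_horizontal[of "size l"] by simp
  next
    case (right y) then show ?thesis using Node.IH(2)[of y] by (auto simp add: packing_shift)
  qed
qed simp

text \<open>The blocks occupy disjoint ranges of abscissas: 2, then from 4 to 4s, then 4s + 2, then
  at least 4s + 6, where s is the size of the left subtree.\<close>

lemma sorted_circ: "sorted_wrt (\<lambda>c c'. Re c < Re c') (circ t)"
proof (induction t)
  case (Node l r)
  have l: "2 \<le> Re c \<and> Re c \<le> 4 * real (size l) - 2" if "c \<in> set (circ l)" for c
    using circ_bounds[OF that] by blast
  have r: "2 \<le> Re c" if "c \<in> set (circ r)" for c
    using circ_bounds[OF that] by blast
  have s: "sorted_wrt (\<lambda>c c'. Re c < Re c') (map (\<lambda>c. c + ascend) (circ l))"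
    "sorted_wrt (\<lambda>c c'. Re c < Re c') (map (\<lambda>c. c + shift l) (circ r))"
    using Node by (simp_all add: sorted_wrt_map)
  show ?case
  proof (cases "l = Leaf")
    case True
    then show ?thesis unfolding circ_Node using s(2) by (auto dest!: r)
  next
    case False
    then show ?thesis unfolding circ_Node using s size_pos[of l]
      by (auto simp: sorted_wrt_append dest!: l r)
  qed
qed simp

section \<open>Circles touching a path from below\<close>

text \<open>A weakening of the height condition in \<open>lies_below\<close> to the centre alone,
  compatible with translation. Since the path enters no open disc of the packing, it suffices for
  the whole circle.\<close>

definition clear :: "complex \<Rightarrow> complex set \<Rightarrow> bool" where
  "clear c S \<longleftrightarrow> (\<forall>z\<in>S. \<bar>Re z - Re c\<bar> \<le> 2 \<longrightarrow> Im c \<le> Im z)"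

lemma clearD: "clear c S \<Longrightarrow> z \<in> S \<Longrightarrow> \<bar>Re z - Re c\<bar> \<le> 2 \<Longrightarrow> Im c \<le> Im z"
  unfolding clear_def by blast

lemma Im_eq_of_extreme:
  assumes "x\<^sup>2 + (b - a)\<^sup>2 = (4::real)" "\<bar>x\<bar> = 2"
  shows "b = a"
proof -
  have "x\<^sup>2 = 4" using power2_abs[of x] unfolding assms(2) by simp
  then show ?thesis using assms(1) by simp
qed

text \<open>Circles on the axis are clear by nonnegativity of the path. A circle of a subtree is
  compared with the points of that subtree by induction; every other arc is out of its horizontal
  extent, or the circle is in the lowest row of the subtree and the arc is at least as high as its
  centre.\<close>

lemma clear_circ:
  assumes "c \<in> set (circ t)"
  shows "clear c (tree_points t)"
  using assms
proof (induction t arbitrary: c)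
  case (Node l r)
  have "Im c \<le> Im z" if z: "z \<in> tree_points (Node l r)" and d: "\<bar>Re z - Re c\<bar> \<le> 2" for z
  proof -
    have z0: "0 \<le> Im z" using tree_points_bounds[OF _ z] by simp
    note b = arc_Re[of z] arc_upper[of z] arc_norm[of z]
    from Node.prems show ?thesis
    proof (cases rule: circ_cases)
      case (left y)
      then have y: "2 \<le> Re y" "Re y \<le> 4 * real (size l) - 2"
        "Im y = 0 \<or> 4 \<le> Re y \<and> Re y \<le> 4 * real (size l) - 4"
        using circ_bounds[of y l] by auto
      from z show ?thesis
      proof (cases rule: tree_points_cases)
        case Ubar
        \<comment> \<open>Only the end of this arc is within reach of the circle; it is the
          rightmost point of its carrier, hence at height 2 sqrt 3, the height of c.\<close>
        have "Re z = 2" "Im y = 0" using b(2)[OF Ubar(2)] d y left by auto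
        moreover have "Im z = 2 * sqrt 3"
          by (rule Im_eq_of_extreme[of "Re z"])
             (use b(4)[OF Ubar(2)] \<open>Re z = 2\<close> in \<open>simp_all add: power2_eq_square\<close>)
        ultimately show ?thesis using left by simp
      next
        case U
        then have "Im y = 0" using b(2)[OF U(2)] d y left by auto
        then show ?thesis using b(3)[OF U(2)] left by simp
      next
        case (left y')
        then show ?thesis
          using clearD[OF Node.IH(1)[of y], of y'] d \<open>y \<in> set (circ l)\<close> \<open>c = y + ascend\<close> by simp
      next
        case Dbar
        have *: "Re z = 4 * real (size l) + 2" "Im y = 0" using b(1)[OF Dbar(2)] d y left by auto
        moreover have "Im z = 2 * sqrt 3"
          by (rule Im_eq_of_extreme[of "Re z - (4 * real (size l) + 4)"])
             (use b(4)[OF Dbar(2)] * in \<open>simp_all add: power2_eq_square\<close>)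
        ultimately show ?thesis using left by simp
      next
        case D
        then show ?thesis using b(1)[OF D(2)] d y left by simp
      next
        case Fbar
        then show ?thesis using b(1)[OF Fbar(2)] d y left by simp
      next
        case (right y')
        then show ?thesis using tree_points_bounds[of r y'] d y left by simp
      qed (use left in simp)
    next
      case (right y)
      then have y: "2 \<le> Re y" "Im y = 0 \<or> 4 \<le> Re y" using circ_bounds[of y r] by auto
      from z show ?thesis
      proof (cases rule: tree_points_cases)
        case F
        then show ?thesis using b(2)[OF F(2)] d y right by simp
      next
        case Ubar
        then show ?thesis using b(2)[OF Ubar(2)] d y right by simp
      next
        case U
        then show ?thesis using b(2)[OF U(2)] d y right size_pos[of l] by simp
      next
        case (left y')
        then show ?thesis using tree_points_bounds[of l y'] d y right by simp
      next
        case Dbar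
        then show ?thesis using b(2)[OF Dbar(2)] d y right by simp
      next
        case Fbar
        then have "Im y = 0" using b(2)[OF Fbar(2)] d y right by auto
        then show ?thesis using z0 right by simp
      next
        case (right y')
        then show ?thesis
          using clearD[OF Node.IH(2)[of y], of y'] d \<open>y \<in> set (circ r)\<close> \<open>c = y + shift l\<close> by simp
      qed (use right in simp)
    qed (use z0 in simp_all)
  qed
  then show ?case unfolding clear_def by blast
qed simp

lemma top_points_in_tree_points:
  "first_top \<in> tree_points t" "last_top l \<in> tree_points (Node l r)"
proof -
  show "first_top \<in> tree_points t" by (rule path_start_in)
  show "last_top l \<in> tree_points (Node l r)"
    unfolding tree_points_Node using arc_start_in[of "last_top l"] by simp
qed

lemma tree_points_leftI: "l \<noteq> Leaf \<Longrightarrow> y \<in> tree_points l \<Longrightarrow> y + ascend \<in> tree_points (Node l r)"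
  unfolding tree_points_Node by simp

lemma tree_points_rightI: "r \<noteq> Leaf \<Longrightarrow> y \<in> tree_points r \<Longrightarrow> y + shift l \<in> tree_points (Node l r)"
  unfolding tree_points_Node by simp

text \<open>The first circle is touched at \<open>first_top\<close> and the returning one at
  \<open>last_top l\<close>; the others come from the subtrees.\<close>

lemma touch_circ:
  assumes "c \<in> set (circ t)"
  shows "\<exists>z\<in>tree_points t. (Re z - Re c)\<^sup>2 + (Im z - Im c)\<^sup>2 = 4"
  using assms
proof (induction t arbitrary: c)
  case (Node l r)
  from Node.prems show ?case
  proof (cases rule: circ_cases)
    case first
    then show ?thesis by (intro bexI[OF _ top_points_in_tree_points(1)]) simp
  next
    case return
    then show ?thesis by (intro bexI[OF _ top_points_in_tree_points(2)]) simp
  next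
    case (left y)
    then obtain z where "z \<in> tree_points l" "(Re z - Re y)\<^sup>2 + (Im z - Im y)\<^sup>2 = 4"
      using Node.IH(1) by blast
    with left show ?thesis
      by (intro bexI[of _ "z + ascend"]) (auto intro: tree_points_leftI simp del: after_first.simps)
  next
    case (right y)
    then obtain z where "z \<in> tree_points r" "(Re z - Re y)\<^sup>2 + (Im z - Im y)\<^sup>2 = 4"
      using Node.IH(2) by blast
    with right show ?thesis
      by (intro bexI[of _ "z + shift l"]) (auto intro: tree_points_rightI simp del: after_first.simps)
  qed
qed simp

lemma packing_minus_ascend: "c \<in> packing_centers \<Longrightarrow> c - ascend \<in> packing_centers"
  unfolding ascend_def by (rule packing_shift_down)

lemma packing_minus_shift: "c \<in> packing_centers \<Longrightarrow> c - shift l \<in> packing_centers"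
  using packing_translate[of c "- int (size l) - 1" 0] by (simp add: shift_def algebra_simps)

lemma circ_leftI: "l \<noteq> Leaf \<Longrightarrow> y \<in> set (circ l) \<Longrightarrow> y + ascend \<in> set (circ (Node l r))"
  unfolding circ_Node by simp

lemma circ_rightI: "y \<in> set (circ r) \<Longrightarrow> y + shift l \<in> set (circ (Node l r))"
  unfolding circ_Node by simp

lemma circ_returnI: "of_real (4 * real (size l) + 2) \<in> set (circ (Node l r))"
  by (simp add: circ_Node)

lemma two_in_circ: "t \<noteq> Leaf \<Longrightarrow> 2 \<in> set (circ t)"
  by (cases t) auto

text \<open>By \<open>arc_touch\<close> each arc meets at most three circles. Those outside the
  sequence have their centre above a top point of the path within their horizontal extent, so they
  are not clear. The one exception is the circle that touches the end of the path from the
  right.\<close>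

lemma touching_clear_in_circ:
  assumes "t \<noteq> Leaf" "c \<in> packing_centers" "clear c (tree_points t)"
    "z \<in> tree_points t" "(Re z - Re c)\<^sup>2 + (Im z - Im c)\<^sup>2 = 4"
  shows "c \<in> set (circ t) \<or> c = of_real (4 * real (size t) + 2)"
  using assms
proof (induction t arbitrary: c z)
  case (Node l r)
  let ?n = "real (size l)"
  note cl = clearD[OF Node.prems(3)]
  note touch = arc_touch[OF _ Node.prems(2) _ Node.prems(5)]
  note pk = arc_center_packing
  \<comment> \<open>\<open>nf\<close> and \<open>nl\<close> discard candidates whose centre is above
    \<open>first_top\<close> or \<open>last_top l\<close> while that point is within their
    horizontal extent.\<close>
  have nf: False if "c = x" "\<bar>1 - Re x\<bar> \<le> 2" "sqrt 3 < Im x" for x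
    using cl[OF top_points_in_tree_points(1)] that by simp
  have nl: False if "c = x" "\<bar>4 * ?n + 3 - Re x\<bar> \<le> 2" "sqrt 3 < Im x" for x
    using cl[OF top_points_in_tree_points(2)] that by simp
  have ret: "of_real (4 * ?n + 2) \<in> set (circ (Node l r))" by (rule circ_returnI)
  have s3: "sqrt 3 < 2 * sqrt (3::real)" by simp
  have from_left: ?case if l: "l \<noteq> Leaf" and y: "y \<in> tree_points l" "z = y + ascend"
    and e: "(Re z - Re c)\<^sup>2 + (Im z - Im c)\<^sup>2 = 4" for y z
  proof -
    have "clear (c - ascend) (tree_points l)"
      using cl[OF tree_points_leftI[OF l]] by (auto simp: clear_def algebra_simps)
    then have "c - ascend \<in> set (circ l) \<or> c - ascend = of_real (4 * ?n + 2)"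
      using Node.IH(1)[OF l packing_minus_ascend[OF Node.prems(2)] _ y(1)] e y(2) by (simp add: algebra_simps)
    then show ?thesis
    proof
      assume "c - ascend \<in> set (circ l)"
      then show ?thesis using circ_leftI[OF l, of "c - ascend" r] by simp
    next
      \<comment> \<open>The exceptional circle of the left part, once raised, has its centre above
        \<open>last_top l\<close>.\<close>
      assume "c - ascend = of_real (4 * ?n + 2)"
      then have "c = of_real (4 * ?n + 2) + ascend" by (simp add: algebra_simps)
      then show ?thesis using nl[of "of_real (4 * ?n + 2) + ascend"] s3 by simp
    qed
  qed
  from Node.prems(4) show ?case
  proof (cases rule: tree_points_cases)
    case F
    have "last_top l = first_top + 2" using F by (simp add: complex_eq_iff)
    consider "c = 2" | "c = Complex 0 (2 * sqrt 3)" | "c = Complex 4 (2 * sqrt 3)"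
      using touch[OF pk(1) F(2)] by (auto simp: complex_eq_iff)
    then show ?thesis
      using nf[of "Complex 0 (2 * sqrt 3)"] nl[of "Complex 4 (2 * sqrt 3)"] F s3 two_in_circ[of "Node l r"]
      by cases (simp_all del: circ.simps)
  next
    case Ubar
    consider "c = Complex 0 (2 * sqrt 3)" | "c = 2" | "c = 2 + ascend"
      using touch[OF pk(2) Ubar(2)] by (auto simp: complex_eq_iff)
    then show ?thesis
      using nf[of "Complex 0 (2 * sqrt 3)"] s3 two_in_circ[of "Node l r"]
        circ_leftI[OF Ubar(1) two_in_circ[OF Ubar(1)], of r]
      by cases (simp_all del: circ.simps)
  next
    case U
    \<comment> \<open>This point has height 3 sqrt 3 and refutes the candidate at height 4 sqrt
      3.\<close>
    have p: "first_top + ascend \<in> tree_points (Node l r)"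
      using U(1) path_start_in by (rule tree_points_leftI)
    consider "c = 2 + ascend" | "c = Complex 0 (2 * sqrt 3)" | "c = Complex 2 (4 * sqrt 3)"
      using touch[OF pk(3) U(2)] by (auto simp: complex_eq_iff)
    then show ?thesis
      using nf[of "Complex 0 (2 * sqrt 3)"] s3 cl[OF p] circ_leftI[OF U(1) two_in_circ[OF U(1)], of r]
      by cases (simp_all del: circ.simps)
  next
    case (left y)
    then show ?thesis using from_left Node.prems(5) by blast
  next
    case Dbar
    let ?p = "ascend + of_real (4 * ?n)"
    have p: "?p = of_real (4 * ?n) + ascend" "of_real (4 * ?n) \<in> tree_points l"
      using path_end_in[of first_top "after_first l"] after_first_end[OF Dbar(1)] by simp_all
    from touch[OF pk(4) Dbar(2)] consider "c = of_real (4 * ?n + 2) + ascend" | "z = ?p"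
      | "c = of_real (4 * ?n + 2)"
      by (auto simp: complex_eq_iff)
    then show ?thesis
    proof cases
      case 1
      then show ?thesis using nl[of "of_real (4 * ?n + 2) + ascend"] s3 by simp
    next
      case 2
      \<comment> \<open>The start of \<open>Dbar\<close> is also the end of the raised left
        part.\<close>
      then show ?thesis using from_left[OF Dbar(1) p(2)] p(1) Node.prems(5) by metis
    next
      case 3
      then show ?thesis using ret by blast
    qed
  next
    case D
    consider "c = of_real (4 * ?n + 2)" | "c = Complex (4 * ?n + 4) (2 * sqrt 3)" | "c = of_real (4 * ?n + 6)"
      using touch[OF pk(5) D(2)] by (auto simp: complex_eq_iff)
    then show ?thesis
      using nl[of "Complex (4 * ?n + 4) (2 * sqrt 3)"] s3 D(1) ret
      by cases (simp_all del: circ.simps of_real_add of_real_mult)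
  next
    case Fbar
    consider "c = Complex (4 * ?n + 4) (2 * sqrt 3)" | "c = of_real (4 * ?n + 2)" | "c = 2 + shift l"
      using touch[OF pk(6) Fbar(2)] by (auto simp: complex_eq_iff)
    then show ?thesis
      using nl[of "Complex (4 * ?n + 4) (2 * sqrt 3)"] s3 circ_rightI[OF two_in_circ[OF Fbar(1)], of l] ret
      by cases (simp_all del: circ.simps of_real_add of_real_mult)
  next
    case (right y)
    have "clear (c - shift l) (tree_points r)"
      using cl[OF tree_points_rightI[OF right(1)]] by (auto simp: clear_def algebra_simps)
    then have "c - shift l \<in> set (circ r) \<or> c - shift l = of_real (4 * real (size r) + 2)"
      using Node.IH(2)[OF right(1) packing_minus_shift[OF Node.prems(2)] _ right(2)]
        Node.prems(5) right(3) by (simp add: algebra_simps)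
    then show ?thesis
    proof
      assume "c - shift l \<in> set (circ r)"
      then show ?thesis using circ_rightI[of "c - shift l" r l] by simp
    next
      assume "c - shift l = of_real (4 * real (size r) + 2)"
      then have "c = of_real (4 * real (size (Node l r)) + 2)" by (simp add: complex_eq_iff)
      then show ?thesis by blast
    qed
  qed
qed simp

section \<open>Parsing inchworm paths\<close>

lemma sublist_pair_Cons:
  "sublist [a, b] (x # w) \<longleftrightarrow> x = a \<and> w \<noteq> [] \<and> hd w = b \<or> sublist [a, b] w"
  unfolding sublist_Cons_right by (cases w) auto

lemma sublist_pair_append:
  "sublist [a, b] (u @ v) \<longleftrightarrow>
    sublist [a, b] u \<or> sublist [a, b] v \<or> u \<noteq> [] \<and> v \<noteq> [] \<and> last u = a \<and> hd v = b"
proof (induction u)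
  case (Cons x u)
  then show ?case by (cases u) (auto simp: sublist_pair_Cons)
qed simp

lemma after_first_ends:
  "t \<noteq> Leaf \<Longrightarrow> after_first t \<noteq> [] \<and> hd (after_first t) \<in> {F, Ubar} \<and> last (after_first t) = D"
proof (induction t)
  case (Node l r)
  then show ?case by (cases "r = Leaf") auto
qed simp

text \<open>Every \<open>Ubar\<close> is followed by \<open>U\<close>, and a \<open>D\<close> inside
  the word ends a raised part and is followed by \<open>Dbar\<close>.\<close>

lemma after_first_no_turn:
  "\<not> sublist [Ubar, Dbar] (after_first t) \<and> \<not> sublist [D, U] (after_first t)"
proof (induction t)
  case (Node l r)
  then show ?case
    using after_first_ends[of l] after_first_ends[of r]
    by (auto simp: sublist_pair_append sublist_pair_Cons)
qed simp

lemma after_first_end_at: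
  assumes "t \<noteq> Leaf"
  shows "foldl arc_end p (after_first t) = p + Complex (4 * real (size t) - 1) (- sqrt 3)"
proof -
  have "foldl arc_end (first_top + (p - first_top)) (after_first t) = of_real (4 * real (size t)) + (p - first_top)"
    unfolding foldl_arc_end_translate after_first_end[OF assms] ..
  then show ?thesis by (simp add: complex_eq_iff)
qed

text \<open>Any other step would have a carrier at a positive distance less than 4 from the given
  centre. The same argument serves the other two kinds of tangency points.\<close>

lemma steps_from_top_left:
  assumes "p + Complex 1 (- sqrt 3) \<in> packing_centers" "arc_center p s \<in> packing_centers"
  shows "s = F \<or> s = Ubar"
  using packing_eqI[OF assms(2,1)] by (cases s) (auto simp: complex_eq_iff power_mult_distrib)

lemma steps_from_top_right:
  assumes "p + Complex (- 1) (- sqrt 3) \<in> packing_centers" "arc_center p s \<in> packing_centers"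
  shows "s = D \<or> s = Fbar"
  using packing_eqI[OF assms(2,1)] by (cases s) (auto simp: complex_eq_iff power_mult_distrib)

lemma steps_from_side:
  assumes "p + 2 \<in> packing_centers" "arc_center p s \<in> packing_centers"
  shows "s = U \<or> s = Dbar"
  using packing_eqI[OF assms(2,1)] by (cases s) (auto simp: complex_eq_iff power_mult_distrib)

text \<open>Strong induction on the length, starting at the top left point of a circle. The
  assumption that the word ends lower than p guarantees at each stage that a further step exists;
  the unread rest is \<open>w'\<close>.\<close>

lemma parse_after_first:
  assumes "p + Complex 1 (- sqrt 3) \<in> packing_centers" "carriers p w \<subseteq> packing_centers"
    "\<not> sublist [Ubar, Dbar] w" "\<not> sublist [D, U] w" "Im (foldl arc_end p w) < Im p"
  shows "\<exists>t w'. t \<noteq> Leaf \<and> w = after_first t @ w'"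
  using assms
proof (induction "length w" arbitrary: p w rule: less_induct)
  case less
  \<comment> \<open>Parsing from the top right point of a circle: \<open>D\<close> stops, while
    \<open>Fbar\<close> leads to the top left point of the next circle.\<close>
  have tail: "\<exists>r w'. w1 = (if r = Leaf then [D] else Fbar # after_first r) @ w'"
    if len: "length w1 < length w" and q: "q + Complex (- 1) (- sqrt 3) \<in> packing_centers"
      and c: "carriers q w1 \<subseteq> packing_centers" and n: "\<not> sublist [Ubar, Dbar] w1" "\<not> sublist [D, U] w1"
      and e: "Im (foldl arc_end q w1) < Im q" for q w1
  proof -
    obtain s w2 where w1: "w1 = s # w2" using e by (cases w1) auto
    have "arc_center q s \<in> packing_centers" using c w1 by simp
    then consider "s = D" | "s = Fbar" using steps_from_top_right[OF q] by blast
    then show ?thesis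
    proof cases
      case 1
      then have "w1 = (if Leaf = Leaf then [D] else Fbar # after_first Leaf) @ w2" using w1 by simp
      then show ?thesis by blast
    next
      case 2
      \<comment> \<open>The next circle in the row is 4 to the right.\<close>
      have eq: "q + Complex (- 1) (- sqrt 3) + of_real (4 * real 1) = q + 2 + Complex 1 (- sqrt 3)"
        by (simp add: complex_eq_iff)
      have "q + 2 + Complex 1 (- sqrt 3) \<in> packing_centers"
        using packing_shift_horizontal[OF q, of 1] unfolding eq .
      then obtain r w' where "r \<noteq> Leaf" "w2 = after_first r @ w'"
        using less.hyps[of w2 "q + 2"] len c n e w1 2 by (auto simp: sublist_pair_Cons)
      then have "w1 = (if r = Leaf then [D] else Fbar # after_first r) @ w'" using w1 2 by simp
      then show ?thesis by blast
    qed
  qed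
  obtain s w1 where w: "w = s # w1" using less.prems(5) by (cases w) auto
  have "arc_center p s \<in> packing_centers" using less.prems(2) w by simp
  then consider "s = F" | "s = Ubar" using steps_from_top_left[OF less.prems(1)] by blast
  then show ?case
  proof cases
    case 1
    have eq: "p + 2 + Complex (- 1) (- sqrt 3) = p + Complex 1 (- sqrt 3)" by (simp add: complex_eq_iff)
    have "p + 2 + Complex (- 1) (- sqrt 3) \<in> packing_centers" using less.prems(1) unfolding eq .
    then obtain r w' where "w1 = (if r = Leaf then [D] else Fbar # after_first r) @ w'"
      using tail[of w1 "p + 2"] less.prems(2-5) w 1 by (auto simp: sublist_pair_Cons)
    then have "w = after_first (Node Leaf r) @ w'" using w 1 by simp
    then show ?thesis by blast
  next
    case 2
    define p1 where "p1 = p + Complex 1 (sqrt 3)"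
    define p2 where "p2 = p1 + Complex 1 (sqrt 3)"
    have Im12: "Im p1 = Im p + sqrt 3" "Im p2 = Im p + 2 * sqrt 3" by (simp_all add: p1_def p2_def)
    have c1: "carriers p1 w1 \<subseteq> packing_centers" and e1: "Im (foldl arc_end p1 w1) < Im p"
      using less.prems(2,5) w 2 by (simp_all add: p1_def)
    obtain s1 w2 where w1: "w1 = s1 # w2" using e1 Im12(1) by (cases w1) auto
    have "p1 + 2 = p + Complex 1 (- sqrt 3) + ascend" by (simp add: p1_def complex_eq_iff)
    then have p1: "p1 + 2 \<in> packing_centers" using packing_ascend[OF less.prems(1)] by simp
    have "arc_center p1 s1 \<in> packing_centers" using c1 w1 by simp
    \<comment> \<open>The alternative \<open>Dbar\<close> would complete the forbidden pair
      \<open>Ubar\<close>, \<open>Dbar\<close>.\<close>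
    then have s1: "s1 = U" using steps_from_side[OF p1] less.prems(3) w w1 2
      by (auto simp: sublist_pair_Cons)
    have p2: "p2 + Complex 1 (- sqrt 3) = p1 + 2" by (simp add: p2_def complex_eq_iff)
    have c2: "carriers p2 w2 \<subseteq> packing_centers" and e2: "Im (foldl arc_end p2 w2) < Im p"
      using c1 e1 w1 s1 by (simp_all add: p2_def)
    \<comment> \<open>The remaining word ends below p, hence below \<open>p2\<close>, so the
      induction hypothesis applies to the raised part.\<close>
    have "Im p < Im p2" by (simp add: Im12)
    then obtain l w3 where l: "l \<noteq> Leaf" and w2: "w2 = after_first l @ w3"
      using less.hyps[of w2 p2] p2 p1 c2 e2 less.prems(3,4) w w1 by (auto simp: sublist_pair_Cons)
    define p3 where "p3 = foldl arc_end p2 (after_first l)"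
    have p3': "p3 = p2 + Complex (4 * real (size l) - 1) (- sqrt 3)"
      unfolding p3_def by (rule after_first_end_at[OF l])
    have Im3: "Im p3 = Im p + sqrt 3" by (simp add: p3' Im12)
    have c3: "carriers p3 w3 \<subseteq> packing_centers" and e3: "Im (foldl arc_end p3 w3) < Im p"
      using c2 e2 unfolding w2 by (simp_all add: carriers_append p3_def)
    obtain s3 w4 where w3: "w3 = s3 # w4" using e3 Im3 by (cases w3) auto
    have "p3 + 2 = p1 + 2 + of_real (4 * real (size l))" by (simp add: p3' p2_def complex_eq_iff)
    then have p3: "p3 + 2 \<in> packing_centers" using packing_shift_horizontal[OF p1, of "size l"] by (simp only:)
    have "arc_center p3 s3 \<in> packing_centers" using c3 w3 by simp
    then have s3: "s3 = Dbar"
      using steps_from_side[OF p3] less.prems(4) after_first_ends[OF l]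
      unfolding w w1 w2 w3 by (auto simp: sublist_pair_Cons sublist_pair_append)
    define p4 where "p4 = p3 + Complex 1 (- sqrt 3)"
    have "p4 + Complex (- 1) (- sqrt 3) = p3 + 2 - ascend" by (simp add: p4_def complex_eq_iff)
    then have p4: "p4 + Complex (- 1) (- sqrt 3) \<in> packing_centers"
      using packing_minus_ascend[OF p3] by simp
    have c4: "carriers p4 w4 \<subseteq> packing_centers" and e4: "Im (foldl arc_end p4 w4) < Im p4"
      using c3 e3 Im3 unfolding w3 s3 by (simp_all add: p4_def)
    have n4: "\<not> sublist [Ubar, Dbar] w4" "\<not> sublist [D, U] w4" "length w4 < length w"
      using less.prems(3,4) unfolding w w1 w2 w3 by (simp_all add: sublist_pair_Cons sublist_pair_append)
    obtain r w' where "w4 = (if r = Leaf then [D] else Fbar # after_first r) @ w'"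
      using tail[OF n4(3) p4 c4 n4(1,2) e4] by blast
    then have "w = after_first (Node l r) @ w'" using w w1 w2 w3 l 2 s1 s3 by simp
    then show ?thesis by blast
  qed
qed

lemma inchworm_path_word:
  assumes "inchworm_path P"
  shows "\<exists>t. P = word t"
proof (cases P)
  case Nil
  then have "P = word Leaf" by (simp add: word_def)
  then show ?thesis by blast
next
  case (Cons s w)
  have c: "carriers 0 P \<subseteq> packing_centers" and pts: "\<And>z. z \<in> path_points 0 P \<Longrightarrow> Im z \<ge> 0"
    and e: "Im (foldl arc_end 0 P) = 0" and n: "\<not> sublist [Ubar, Dbar] P" "\<not> sublist [D, U] P"
    using assms unfolding inchworm_path_def packing_path_def path_in_packing_def endpoint_def by auto
  have 0: "0 + 2 \<in> packing_centers" using packing_horizontal[of 0] by simp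
  have "arc_end 0 s \<in> path_points 0 P" unfolding Cons using arc_end_in by simp
  \<comment> \<open>A first step \<open>Dbar\<close> would go below the axis.\<close>
  from pts[OF this] have "s = U"
    using steps_from_side[OF 0, of s] c Cons by auto
  then have P: "P = U # w" using Cons by simp
  have c': "carriers first_top w \<subseteq> packing_centers" and e': "Im (foldl arc_end first_top w) = 0"
    using c e unfolding P by (simp_all add: first_top_def)
  have "first_top + Complex 1 (- sqrt 3) = 0 + 2" by (simp add: complex_eq_iff)
  then obtain t w' where t: "t \<noteq> Leaf" "w = after_first t @ w'"
    using parse_after_first[of first_top w] 0 c' e' n unfolding P by (auto simp: sublist_pair_Cons)
  \<comment> \<open>The parsed part ends on the axis after a \<open>D\<close>: a further
    \<open>U\<close> is a forbidden turn, and \<open>Dbar\<close> goes below the axis.\<close>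
  have "w' = []"
  proof (rule ccontr)
    assume "w' \<noteq> []"
    then obtain s' w'' where w': "w' = s' # w''" by (cases w') auto
    define p where "p = complex_of_real (4 * real (size t))"
    have p: "foldl arc_end 0 (U # after_first t) = p"
      using after_first_end[OF t(1)] by (simp add: first_top_def p_def)
    have P': "P = (U # after_first t) @ s' # w''" unfolding P t(2) w' by simp
    have "p + 2 \<in> packing_centers" using packing_horizontal[of "size t"] by (simp add: p_def)
    moreover have "arc_center p s' \<in> packing_centers"
      using c unfolding P' carriers_append p by simp
    ultimately consider "s' = U" | "s' = Dbar" using steps_from_side by blast
    then show False
    proof cases
      case 1
      then show False using n(2) after_first_ends[OF t(1)] unfolding P'
        by (auto simp: sublist_pair_append sublist_pair_Cons)
    next
      case 2
      have "arc_end p s' \<in> path_points 0 P"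
        unfolding P' path_points_append p using arc_end_in by simp
      from pts[OF this] 2 show False by (simp add: p_def)
    qed
  qed
  then have "P = word t" using P t by (simp add: word_def)
  then show ?thesis by blast
qed

lemma inchworm_word: "inchworm_path (word t)"
proof (cases "t = Leaf")
  case True
  then show ?thesis
    by (simp add: word_def inchworm_path_def packing_path_def path_in_packing_def endpoint_def)
next
  case False
  have w: "word t = U # after_first t" using False by (simp add: word_def)
  have "arc_center 0 U \<in> packing_centers" using packing_horizontal[of 0] by simp
  then have "carriers 0 (word t) \<subseteq> packing_centers"
    using carriers_after_first[of t] unfolding w by (simp add: first_top_def)
  moreover have "Re z \<ge> 0 \<and> Im z \<ge> 0" if "z \<in> path_points 0 (word t)" for z
  proof (cases "z \<in> arc_points 0 U")
    case True
    then show ?thesis using arc_Re[OF True] arc_upper[OF True] by simp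
  next
    case out: False
    then have "z \<in> tree_points t" using that unfolding w by (simp add: first_top_def)
    then show ?thesis using tree_points_bounds[OF False] by force
  qed
  moreover have "Im (endpoint (word t)) = 0"
    using after_first_end[OF False] unfolding w endpoint_def by (simp add: first_top_def)
  moreover have "\<not> sublist [Ubar, Dbar] (word t)" "\<not> sublist [D, U] (word t)"
    using after_first_no_turn[of t] unfolding w by (auto simp: sublist_pair_Cons)
  ultimately show ?thesis
    unfolding inchworm_path_def packing_path_def path_in_packing_def by blast
qed

section \<open>The circle sequence of a path\<close>

lemma word_points:
  "t \<noteq> Leaf \<Longrightarrow> path_points 0 (word t) = arc_points 0 U \<union> tree_points t"
  by (simp add: word_def first_top_def)

lemma word_endpoint: "endpoint (word t) = of_real (4 * real (size t))"
  using after_first_end[of t] by (simp add: endpoint_def word_def first_top_def)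

lemma word_width: "width (word t) = 4 * real (size t)"
  by (simp add: width_def word_endpoint)

section \<open>Lying below a path, in coordinates\<close>

lemma sphere_iff: "z \<in> sphere c 2 \<longleftrightarrow> (Re z - Re c)\<^sup>2 + (Im z - Im c)\<^sup>2 = 4"
proof -
  have "z \<in> sphere c 2 \<longleftrightarrow> cmod (z - c) = 2" by (simp add: dist_norm norm_minus_commute)
  also have "\<dots> \<longleftrightarrow> (cmod (z - c))\<^sup>2 = 4"
    using power2_eq_iff_nonneg[of "cmod (z - c)" 2] by simp
  finally have "z \<in> sphere c 2 \<longleftrightarrow> (cmod (z - c))\<^sup>2 = 4" .
  then show ?thesis by (simp add: cmod_power2)
qed

lemma sphere_Re: "z \<in> sphere c 2 \<Longrightarrow> \<bar>Re z - Re c\<bar> \<le> 2"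
  using abs_Re_le_cmod[of "z - c"] by (simp add: dist_norm norm_minus_commute)

text \<open>On a vertical line, a point outside the open disc and not below the centre is at or
  above the upper semicircle.\<close>

lemma sphere_below:
  assumes "z \<in> sphere c 2" "Re z = Re z'" "Im c \<le> Im z'" "4 \<le> (Re z' - Re c)\<^sup>2 + (Im z' - Im c)\<^sup>2"
  shows "Im z \<le> Im z'"
proof -
  have "(Im z - Im c)\<^sup>2 \<le> (Im z' - Im c)\<^sup>2"
    using assms unfolding sphere_iff by simp
  then have "Im z - Im c \<le> Im z' - Im c" by (rule power2_le_imp_le) (use assms(3) in simp)
  then show ?thesis by simp
qed

lemma lies_below_Re:
  assumes "lies_below c w"
  shows "2 \<le> Re c" "Re c \<le> width w - 2"
proof -
  have "c - 2 \<in> sphere c 2" "c + 2 \<in> sphere c 2" unfolding sphere_iff by simp_all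
  then show "2 \<le> Re c" "Re c \<le> width w - 2" using assms unfolding lies_below_def by fastforce+
qed

lemma lies_below_clear:
  assumes "lies_below c w"
  shows "clear c (path_points 0 w)"
  unfolding clear_def
proof (intro ballI impI)
  fix z' assume z': "z' \<in> path_points 0 w" "\<bar>Re z' - Re c\<bar> \<le> 2"
  \<comment> \<open>Half the vertical chord of the circle at the abscissa of z'; its upper end is at
    or above the height of the centre.\<close>
  define h where "h = sqrt (4 - (Re z' - Re c)\<^sup>2)"
  have "(Re z' - Re c)\<^sup>2 \<le> 2\<^sup>2" using z'(2) by (metis abs_le_square_iff abs_numeral)
  then have h: "0 \<le> h" "h\<^sup>2 = 4 - (Re z' - Re c)\<^sup>2" by (simp_all add: h_def)
  have "Complex (Re z') (Im c + h) \<in> sphere c 2" unfolding sphere_iff using h by simp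
  then have "Im c + h \<le> Im z'"
    using assms z'(1) unfolding lies_below_def by fastforce
  then show "Im c \<le> Im z'" using h(1) by simp
qed

lemma kissing_circles_word: "kissing_circles (word t) = set (circ t)"
proof (cases "t = Leaf")
  case True
  have "\<not> lies_below c []" for c
    using lies_below_Re[of c "[]"] by (force simp: width_def endpoint_def)
  then show ?thesis using True by (simp add: kissing_circles_def word_def)
next
  case False
  have pts: "path_points 0 (word t) = arc_points 0 U \<union> tree_points t"
    by (rule word_points[OF False])
  have p2: "arc_center 0 U \<in> packing_centers" using packing_horizontal[of 0] by simp
  have ne: "after_first t \<noteq> []" using False by (cases t) auto
  show ?thesis
  proof (intro set_eqI iffI)
    fix c assume "c \<in> kissing_circles (word t)"
    then obtain z where c: "c \<in> packing_centers" "lies_below c (word t)"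
      and z: "z \<in> sphere c 2" "z \<in> path_points 0 (word t)"
      unfolding kissing_circles_def by blast
    have Re: "2 \<le> Re c" "Re c \<le> 4 * real (size t) - 2"
      using lies_below_Re[OF c(2)] by (simp_all add: word_width)
    show "c \<in> set (circ t)"
    proof (cases "z \<in> arc_points 0 U")
      case True
      \<comment> \<open>The carrier of the initial arc and its reflections in the two ends; only the
        carrier has abscissa at least 2.\<close>
      from arc_touch[OF p2 c(1) True] z(1)[unfolded sphere_iff]
      have "c = 2 \<or> c = - 2 \<or> c = Complex 0 (2 * sqrt 3)"
        by (auto simp: complex_eq_iff)
      then show ?thesis using Re(1) two_in_circ[OF False] by auto
    next
      case out: False
      have "clear c (tree_points t)"
        using lies_below_clear[OF c(2)] unfolding pts clear_def by blast
      then have "c \<in> set (circ t) \<or> c = of_real (4 * real (size t) + 2)"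
        using touching_clear_in_circ[OF False c(1)] z out unfolding pts sphere_iff by blast
      \<comment> \<open>The exceptional circle lies beyond the width of the path.\<close>
      then show ?thesis using Re(2) by auto
    qed
  next
    fix c assume c: "c \<in> set (circ t)"
    note cb = circ_bounds[OF c]
    have "Im z \<le> Im z'" if z: "z \<in> sphere c 2" "Re z = Re z'" and z': "z' \<in> path_points 0 (word t)" for z z'
    proof (rule sphere_below[OF z])
      show "4 \<le> (Re z' - Re c)\<^sup>2 + (Im z' - Im c)\<^sup>2"
        using z' cb packing_outside[OF p2, of c z'] arc_norm[of z' 0 U]
          path_points_outside[OF carriers_after_first ne, of z' c] unfolding pts by blast
      have d: "\<bar>Re z' - Re c\<bar> \<le> 2" using sphere_Re[OF z(1)] z(2) by simp
      show "Im c \<le> Im z'"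
      proof (cases "z' \<in> arc_points 0 U")
        case True
        then show ?thesis using arc_Re[OF True] arc_upper[OF True] d cb by auto
      next
        case False
        then show ?thesis using clearD[OF clear_circ[OF c] _ d] z' unfolding pts by blast
      qed
    qed
    moreover have "0 \<le> Re z \<and> Re z \<le> width (word t)" if "z \<in> sphere c 2" for z
      using sphere_Re[OF that] cb by (simp add: word_width abs_le_iff)
    moreover obtain z where "z \<in> tree_points t" "(Re z - Re c)\<^sup>2 + (Im z - Im c)\<^sup>2 = 4"
      using touch_circ[OF c] by blast
    then have "z \<in> sphere c 2 \<inter> path_points 0 (word t)" unfolding pts sphere_iff Int_iff by simp
    ultimately show "c \<in> kissing_circles (word t)"
      unfolding kissing_circles_def lies_below_def using cb by blast
  qed
qed

text \<open>Strictness of the order makes \<open>h\<close> injective on the list, as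
  \<open>folding_insort_key\<close> demands, and sorting leaves a sorted list unchanged.\<close>

lemma (in linorder) sorted_key_list_of_set_eq:
  assumes "sorted_wrt (\<lambda>x y. h x < h y) xs"
  shows "sorted_key_list_of_set h (set xs) = xs"
proof -
  have s: "sorted (map h xs)" using assms by (induction xs) (auto intro: less_imp_le)
  have d: "distinct xs" using assms by (induction xs) auto
  have inj: "inj_on h (set xs)" using assms by (induction xs) auto
  interpret folding_insort_key "(\<le>)" "(<)" "set xs" h
    by unfold_locales (rule inj)
  show ?thesis by (rule idem_if_sorted_distinct) (use s d in auto)
qed

lemma circle_sequence_word: "circle_sequence (word t) = circ t"
  unfolding circle_sequence_def kissing_circles_word
  by (rule sorted_key_list_of_set_eq[OF sorted_circ])

lemma distinct_circ: "distinct (circ t)"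
proof -
  have "distinct xs" if "sorted_wrt (\<lambda>x y. Re x < Re y) xs" for xs
    using that by (induction xs) auto
  then show ?thesis using sorted_circ by blast
qed

lemma kissing_number_word: "kissing_number (word t) = length (circ t)"
  unfolding kissing_number_def kissing_circles_word by (rule distinct_card[OF distinct_circ])

section \<open>Dyck paths\<close>

text \<open>Decomposition at the first return to the axis.\<close>

fun dyck :: "btree \<Rightarrow> dyck_step list" where
  "dyck Leaf = []"
| "dyck (Node l r) = Up # dyck l @ Down # dyck r"

lemma length_dyck: "length (dyck t) = 2 * size t"
  by (induction t) auto

lemma sum_rise_dyck: "sum_list (map rise (dyck t)) = 0"
  by (induction t) auto

lemma prefix_rise_dyck: "sum_list (map rise (take m (dyck t))) \<ge> 0"
proof (induction t arbitrary: m)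
  case (Node l r)
  show ?case
  proof (cases m)
    case (Suc k)
    then show ?thesis using Node.IH(1)[of k] Node.IH(2)[of "k - length (dyck l) - 1"]
      by (cases "k - length (dyck l)") (auto simp: sum_rise_dyck)
  qed simp
qed simp

lemma dyck_path_dyck: "dyck_path (dyck t)"
  by (simp add: dyck_path_def prefix_rise_dyck sum_rise_dyck)

text \<open>The displayed \<open>Down\<close> is the first step below the axis, so it marks where
  the tree word ends. This marker makes the induction go through for both subtrees.\<close>

lemma dyck_prefix_unique:
  "dyck t @ Down # x = dyck t' @ Down # x' \<Longrightarrow> t = t' \<and> x = x'"
proof (induction t arbitrary: t' x x')
  case Leaf
  then show ?case by (cases t') auto
next
  case (Node l r)
  from Node.prems obtain l' r' where t': "t' = Node l' r'" by (cases t') auto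
  have "dyck l @ Down # dyck r @ Down # x = dyck l' @ Down # dyck r' @ Down # x'"
    using Node.prems t' by simp
  with Node.IH(1) have "l = l'" "dyck r @ Down # x = dyck r' @ Down # x'" by blast+
  with Node.IH(2) t' show ?case by blast
qed

lemma dyck_inject: "dyck t = dyck t' \<longleftrightarrow> t = t'"
  using dyck_prefix_unique[of t "[]" t' "[]"] by auto

text \<open>After an initial \<open>Up\<close> the rest has sum at most -2, so the induction
  hypothesis splits it twice, which yields the left and the right subtree.\<close>

lemma dyck_prefix_exists:
  "sum_list (map rise q) < 0 \<Longrightarrow> \<exists>t q'. q = dyck t @ Down # q'"
proof (induction "length q" arbitrary: q rule: less_induct)
  case less
  show ?case
  proof (cases q)
    case (Cons s q1)
    show ?thesis
    proof (cases s)
      case Up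
      then obtain l q2 where q1: "q1 = dyck l @ Down # q2"
        using less.hyps[of q1] less.prems Cons Up by auto
      then obtain r q3 where "q2 = dyck r @ Down # q3"
        using less.hyps[of q2] less.prems Cons Up by (auto simp: sum_rise_dyck)
      then have "q = dyck (Node l r) @ Down # q3" using q1 Cons Up by simp
      then show ?thesis by blast
    next
      case Down
      then have "q = dyck Leaf @ Down # q1" using Cons by simp
      then show ?thesis by blast
    qed
  qed (use less.prems in simp)
qed

lemma dyck_surj:
  assumes "dyck_path q"
  shows "\<exists>t. q = dyck t"
proof -
  \<comment> \<open>An appended \<open>Down\<close> makes the sum negative. The \<open>Down\<close>
    that is split off must be this one, since otherwise a prefix of q would have sum -1.\<close>
  have "sum_list (map rise (q @ [Down])) < 0" using assms by (simp add: dyck_path_def)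
  then obtain t q' where q: "q @ [Down] = dyck t @ Down # q'" using dyck_prefix_exists by blast
  show ?thesis
  proof (cases q' rule: rev_cases)
    case Nil
    then show ?thesis using q by auto
  next
    case (snoc q'' s)
    then have q: "q = (dyck t @ [Down]) @ q''" using q by simp
    then have "take (Suc (length (dyck t))) q = dyck t @ [Down]" "Suc (length (dyck t)) \<le> length q"
      by simp_all
    then have "sum_list (map rise (dyck t @ [Down])) \<ge> 0" using assms unfolding dyck_path_def by metis
    then show ?thesis by (simp add: sum_rise_dyck)
  qed
qed

section \<open>Counting peaks\<close>

lemma peaks_Nil: "peaks [] = 0"
  by (simp add: peaks_def)

lemma peaks_Cons:
  "peaks (x # q) = peaks q + (if q \<noteq> [] \<and> x = Up \<and> hd q = Down then 1 else 0)"
proof -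
  have "{i. Suc i < length (x # q) \<and> (x # q) ! i = Up \<and> (x # q) ! Suc i = Down} =
     (if q \<noteq> [] \<and> x = Up \<and> hd q = Down then {0} else {}) \<union>
     Suc ` {i. Suc i < length q \<and> q ! i = Up \<and> q ! Suc i = Down}" (is "?L = ?A \<union> Suc ` ?B")
  proof (intro set_eqI)
    fix i show "i \<in> ?L \<longleftrightarrow> i \<in> ?A \<union> Suc ` ?B"
      by (cases i) (auto simp: hd_conv_nth image_iff)
  qed
  moreover have "finite ?B" by (rule finite_subset[of _ "{..<length q}"]) auto
  ultimately show ?thesis
    unfolding peaks_def by (simp add: card_Un_disjoint card_image)
qed

lemma peaks_append_Down:
  "peaks (q @ Down # q') = peaks q + peaks q' + (if q \<noteq> [] \<and> last q = Up then 1 else 0)"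
proof (induction q)
  case (Cons x q)
  then show ?case by (cases q) (auto simp: peaks_Cons peaks_Nil)
qed (simp add: peaks_Cons peaks_Nil)

lemma last_dyck: "t \<noteq> Leaf \<Longrightarrow> last (dyck t) = Down"
proof (induction t)
  case (Node l r)
  then show ?case by (cases "r = Leaf") (cases r; auto)+
qed simp

text \<open>The closing \<open>Down\<close> forms a peak only if the left part is empty; otherwise
  it follows another \<open>Down\<close>.\<close>

lemma peaks_dyck_Node:
  "peaks (dyck (Node l r)) = (if l = Leaf then 1 else 0) + peaks (dyck l) + peaks (dyck r)"
proof -
  have "peaks (dyck (Node l r)) = peaks ((Up # dyck l) @ Down # dyck r)" by simp
  also have "\<dots> = (if l = Leaf then 1 else 0) + peaks (dyck l) + peaks (dyck r)"
    unfolding peaks_append_Down using last_dyck[of l] by (cases l) (auto simp: peaks_Cons peaks_Nil)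
  finally show ?thesis .
qed

text \<open>Each node contributes 2: one peak and one circle if its left subtree is empty, no peak
  and two circles otherwise.\<close>

lemma peaks_plus_circles: "peaks (dyck t) + length (circ t) = 2 * size t"
proof (induction t)
  case Leaf
  then show ?case by (simp add: peaks_Nil)
next
  case (Node l r)
  then show ?case unfolding peaks_dyck_Node by (cases "l = Leaf") (auto simp: peaks_Nil simp del: dyck.simps(2))
qed

section \<open>The map on circle sequences\<close>

lemma word_eq_Nil: "word t = [] \<longleftrightarrow> t = Leaf"
  by (simp add: word_def)

lemma circ_eq_Nil: "circ t = [] \<longleftrightarrow> t = Leaf"
  by (cases t) auto

lemma hd_circ: "t \<noteq> Leaf \<Longrightarrow> hd (circ t) = 2"
  by (cases t) auto

lemma first_axis_split:
  assumes "xs @ c # ys = xs' @ c' # ys'"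
    "\<forall>x\<in>set xs. Im x \<noteq> 0" "\<forall>x\<in>set xs'. Im x \<noteq> 0" "Im c = 0" "Im c' = 0"
  shows "xs = xs' \<and> c = c' \<and> ys = ys'"
proof -
  have *: "takeWhile (\<lambda>x. Im x \<noteq> 0) (xs @ c # ys) = xs"
    if "\<forall>x\<in>set xs. Im x \<noteq> 0" "Im c = 0" for xs ys :: "complex list" and c
    using that by simp
  have "xs = xs'" using *[OF assms(2,4), of ys] *[OF assms(3,5), of ys'] assms(1) by simp
  then show ?thesis using assms(1) by simp
qed

lemma raised_circ: "\<forall>c\<in>set (map (\<lambda>c. c + ascend) (circ t)). Im c \<noteq> 0"
proof
  fix c assume "c \<in> set (map (\<lambda>c. c + ascend) (circ t))"
  then obtain y where y: "y \<in> set (circ t)" "c = y + ascend" by auto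
  have "0 < 2 * sqrt (3::real)" by simp
  then show "Im c \<noteq> 0" using circ_bounds[OF y(1)] y(2) by (simp del: real_sqrt_gt_0_iff)
qed

lemma map_add_inject: "map (\<lambda>c. c + a) xs = map (\<lambda>c. c + (a::complex)) ys \<longleftrightarrow> xs = ys"
  by (rule inj_map_eq_map) (simp add: inj_def)

text \<open>The second circle of a sequence lies on the axis exactly in form (a).\<close>

lemma no_raised_head:
  assumes "l \<noteq> Leaf"
  shows "map (\<lambda>c. c + ascend) (circ l) @ xs \<noteq> map (\<lambda>c. c + of_real s) (circ t)"
proof
  assume eq: "map (\<lambda>c. c + ascend) (circ l) @ xs = map (\<lambda>c. c + of_real s) (circ t)"
  then have "t \<noteq> Leaf" using assms by (cases t) (auto simp: circ_eq_Nil)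
  have "2 + ascend = hd (map (\<lambda>c. c + ascend) (circ l) @ xs)"
    using assms hd_circ[OF assms] by (simp add: circ_eq_Nil hd_map)
  also have "\<dots> = 2 + of_real s"
    unfolding eq using \<open>t \<noteq> Leaf\<close> hd_circ[of t] by (simp add: circ_eq_Nil hd_map)
  finally have "Im (2 + ascend) = Im (2 + of_real s)" by simp
  then show False by simp
qed

text \<open>Two independent translations are allowed because \<open>f_graph\<close> leaves the
  horizontal translation open; the common first circle 2 forces them to agree.\<close>

lemma circ_shift_inject:
  "map (\<lambda>c. c + of_real a) (circ t) = map (\<lambda>c. c + of_real b) (circ t') \<Longrightarrow> t = t'"
proof (induction t arbitrary: a b t')
  case Leaf
  then show ?case by (simp add: circ_eq_Nil)
next
  case (Node l r)
  then have "t' \<noteq> Leaf" by auto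
  then obtain l' r' where t': "t' = Node l' r'" by (cases t') auto
  have "a = b" using arg_cong[OF Node.prems, of hd] by (simp add: t')
  then have eq: "circ (Node l r) = circ (Node l' r')" using Node.prems unfolding t' by (simp only: map_add_inject)
  show ?case
  proof (cases "l = Leaf")
    case l: True
    then have eq': "tl (circ (Node l' r')) = map (\<lambda>c. c + shift Leaf) (circ r)"
      using arg_cong[OF eq, of tl] unfolding l by (simp add: circ_Node del: circ.simps)
    have l': "l' = Leaf"
      \<comment> \<open>The 4 is the abscissa of \<open>shift Leaf\<close>.\<close>
      using no_raised_head[of l' _ 4 r] eq' unfolding circ_Node shift_def by (cases "l' = Leaf") auto
    then have "map (\<lambda>c. c + shift Leaf) (circ r') = map (\<lambda>c. c + shift Leaf) (circ r)"
      using eq' unfolding circ_Node by simp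
    then show ?thesis using Node.IH(2) l l' t' unfolding shift_def by metis
  next
    case l: False
    have l': "l' \<noteq> Leaf"
    proof
      assume "l' = Leaf"
      then have "tl (circ (Node l r)) = map (\<lambda>c. c + shift Leaf) (circ r')"
        unfolding eq by (simp add: circ_Node del: circ.simps)
      then show False using no_raised_head[OF l, of _ 4 r'] l unfolding circ_Node shift_def by auto
    qed
    have "map (\<lambda>c. c + ascend) (circ l) @ of_real (4 * real (size l) + 2) # map (\<lambda>c. c + shift l) (circ r) =
        map (\<lambda>c. c + ascend) (circ l') @ of_real (4 * real (size l') + 2) # map (\<lambda>c. c + shift l') (circ r')"
      using eq l l' unfolding circ_Node by simp
    from first_axis_split[OF this raised_circ raised_circ]
    have 1: "circ l = circ l'" and 2: "map (\<lambda>c. c + shift l) (circ r) = map (\<lambda>c. c + shift l') (circ r')"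
      by (simp_all add: map_add_inject)
    have "l = l'" using Node.IH(1)[of 0 0 l'] 1 by simp
    moreover have "r = r'" using Node.IH(2) 2 unfolding shift_def by blast
    ultimately show ?thesis using t' by simp
  qed
qed

lemma circ_inject: "circ t = circ t' \<Longrightarrow> t = t'"
  using circ_shift_inject[of 0 t 0 t'] by simp

section \<open>Values of the recursive map\<close>

lemma f_graph_dyck: "f_graph (word t) (dyck t)"
proof (induction t)
  case Leaf
  then show ?case by (simp add: word_def f_graph.empty)
next
  case (Node l r)
  show ?case
  proof (cases "l = Leaf")
    case True
    have "f_graph (word (Node l r)) ([Up, Down] @ dyck r)"
      by (rule f_graph.form_a[OF inchworm_word inchworm_word _ Node.IH(2), of _ 2 "4 * real (size l) + 4"])
         (simp add: circle_sequence_word circ_Node True shift_def)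
    then show ?thesis using True by simp
  next
    case False
    have "f_graph (word (Node l r)) ([Up] @ dyck l @ [Down] @ dyck r)"
    proof (rule f_graph.form_b[OF inchworm_word inchworm_word _ inchworm_word refl refl _ _ _ Node.IH])
      show "word l \<noteq> []" using False by (simp add: word_eq_Nil)
      show "circle_sequence (word (Node l r)) = 2 # map (\<lambda>c. c + Complex 2 (2 * sqrt 3)) (circle_sequence (word l)) @
          of_real (4 * real (size l) + 2) # map (\<lambda>c. c + of_real (4 * real (size l) + 4)) (circle_sequence (word r))"
        using False by (simp add: circle_sequence_word)
      show "\<forall>c\<in>set (map (\<lambda>c. c + Complex 2 (2 * sqrt 3)) (circle_sequence (word l))). Im c \<noteq> 0"
        using raised_circ[of l] unfolding circle_sequence_word ascend_def .
    qed simp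
    then show ?thesis by simp
  qed
qed

text \<open>The height of the second circle ties each rule to the shape of the tree, and injectivity
  of circle sequences identifies the subpaths with the subtrees.\<close>

lemma f_graph_word_unique: "f_graph P Q \<Longrightarrow> P = word t \<Longrightarrow> Q = dyck t"
proof (induction arbitrary: t rule: f_graph.induct)
  case empty
  then show ?case using word_eq_Nil[of t] by simp
next
  case (form_a P P' C1 s Q')
  obtain t' where P': "P' = word t'" using inchworm_path_word form_a by blast
  have eq: "circ t = C1 # map (\<lambda>c. c + of_real s) (circ t')"
    using form_a(3) unfolding form_a.prems P' circle_sequence_word .
  then obtain l r where t: "t = Node l r" by (cases t) auto
  have tl: "tl (circ (Node l r)) = map (\<lambda>c. c + of_real s) (circ t')" using eq t by simp
  have l: "l = Leaf" using no_raised_head[of l] tl unfolding circ_Node by (cases "l = Leaf") auto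
  have "map (\<lambda>c. c + of_real (4 * real (size l) + 4)) (circ r) = map (\<lambda>c. c + of_real s) (circ t')"
    using tl l unfolding circ_Node shift_def by simp
  then have "r = t'" by (rule circ_shift_inject)
  then show ?case using form_a.IH P' t l by simp
next
  case (form_b P P' P'' C' C'' s C1 Cj Q' Q'')
  obtain t' where P': "P' = word t'" using inchworm_path_word form_b by blast
  obtain t'' where P'': "P'' = word t''" using inchworm_path_word form_b by blast
  have t': "t' \<noteq> Leaf" using form_b(3) P' by (simp add: word_eq_Nil)
  have C': "C' = map (\<lambda>c. c + ascend) (circ t')"
    using form_b(5) unfolding P' circle_sequence_word ascend_def .
  have C'': "C'' = map (\<lambda>c. c + of_real s) (circ t'')"
    using form_b(6) unfolding P'' circle_sequence_word .
  have eq: "circ t = C1 # C' @ Cj # C''"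
    using form_b(7) unfolding form_b.prems circle_sequence_word .
  then obtain l r where t: "t = Node l r" by (cases t) auto
  have l: "l \<noteq> Leaf"
  proof
    assume "l = Leaf"
    then have "C' @ Cj # C'' = map (\<lambda>c. c + of_real (4 * real (size l) + 4)) (circ r)"
      using eq unfolding t circ_Node shift_def by simp
    then show False using no_raised_head[OF t'] unfolding C' by blast
  qed
  have "map (\<lambda>c. c + ascend) (circ l) @ of_real (4 * real (size l) + 2) # map (\<lambda>c. c + shift l) (circ r) =
      C' @ Cj # C''"
    using eq l unfolding t circ_Node by simp
  from first_axis_split[OF this raised_circ form_b(9) _ form_b(8)]
  have "map (\<lambda>c. c + ascend) (circ l) = map (\<lambda>c. c + ascend) (circ t')"
    and 2: "map (\<lambda>c. c + shift l) (circ r) = map (\<lambda>c. c + of_real s) (circ t'')"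
    unfolding C' C'' by simp_all
  then have "l = t'" using circ_inject by (simp add: map_add_inject)
  moreover have "r = t''" using 2 circ_shift_inject unfolding shift_def by blast
  ultimately show ?case using form_b.IH P' P'' t by simp
qed

lemma f_graph_word_iff: "f_graph (word t) Q \<longleftrightarrow> Q = dyck t"
  using f_graph_dyck f_graph_word_unique by blast

lemma f_word: "f (word t) = dyck t"
  unfolding f_def f_graph_word_iff by simp

lemma inchworm_paths_of_width:
  "{P. inchworm_path P \<and> width P = 4 * real n} = word ` {t. size t = n}"
proof -
  have "P \<in> word ` {t. size t = n}" if "inchworm_path P" "width P = 4 * real n" for P
    using inchworm_path_word[OF that(1)] that(2) by (auto simp: word_width)
  then show ?thesis by (auto simp: inchworm_word word_width)
qed

lemma dyck_paths_of_length:
  "{Q. dyck_path Q \<and> length Q = 2 * n} = dyck ` {t. size t = n}"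
proof -
  have "Q \<in> dyck ` {t. size t = n}" if "dyck_path Q" "length Q = 2 * n" for Q
    using dyck_surj[OF that(1)] that(2) by (auto simp: length_dyck)
  then show ?thesis by (auto simp: dyck_path_dyck length_dyck)
qed

theorem mainTheorem18:
  shows "(\<forall>P. inchworm_path P \<longrightarrow> (\<exists>!Q. f_graph P Q)) \<and>
    (\<forall>n::nat.
       bij_betw f {P. inchworm_path P \<and> width P = 4 * real n}
                  {Q. dyck_path Q \<and> length Q = 2 * n} \<and>
       (\<forall>P. inchworm_path P \<and> width P = 4 * real n \<longrightarrow>
            int (peaks (f P)) = 2 * int n - int (kissing_number P)))"
proof (intro conjI allI impI)
  fix P assume "inchworm_path P"
  then obtain t where "P = word t" using inchworm_path_word by blast
  then show "\<exists>!Q. f_graph P Q" by (simp add: f_graph_word_iff)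
next
  fix n :: nat
  \<comment> \<open>On tree words \<open>f\<close> computes \<open>dyck\<close>, which is injective
    on trees.\<close>
  have "inj_on f (word ` {t. size t = n})"
    by (auto simp: inj_on_def f_word dyck_inject)
  then show "bij_betw f {P. inchworm_path P \<and> width P = 4 * real n} {Q. dyck_path Q \<and> length Q = 2 * n}"
    unfolding inchworm_paths_of_width dyck_paths_of_length bij_betw_def image_image f_word by blast
next
  fix n :: nat and P assume "inchworm_path P \<and> width P = 4 * real n"
  then obtain t where "P = word t" "size t = n" using inchworm_paths_of_width by blast
  then show "int (peaks (f P)) = 2 * int n - int (kissing_number P)"
    using peaks_plus_circles[of t] by (simp add: f_word kissing_number_word)
qed

end
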